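(* Let $D$ be a weakly small division ring of positive characteristic. Then $D$ is locally finite dimensional over its centre: for every finite subset $A$ of $D$, the division ring $\Gamma=\mathrm{acl}(A)$ has finite dimension as a vector space over its centre $Z(\Gamma)$.
   Context: Division rings may carry extra first-order structure beyond the ring language. A first-order structure $M$ is weakly small if for every finite subset $A$ of $M$ there are only countably many complete $1$-types over $A$. $\mathrm{acl}(A)$ denotes the model-theoretic algebraic closure of $A$ in the structure. A structure is said to be locally $P$ if every finitely generated algebraic closure (that is, $\mathrm{acl}(A)$ for $A$ finite) in it has property $P$. *)

theory Defs
  imports Main "HOL-Library.Countable_Set"
begin

text \<open>
  A first-order structure on the type \<open>'a\<close> together with its language, whose symbols are
  \<open>fsyms\<close> and \<open>rsyms\<close>.  Values of the other fields at non-symbols, and values of the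
  interpretations at argument lists of the wrong length, are never used.  Constants are function
  symbols of arity \<open>0\<close>.
\<close>

record ('f, 'r, 'a) fo_struct =
  fsyms  :: "'f set"
  farity :: "'f \<Rightarrow> nat"
  finterp :: "'f \<Rightarrow> 'a list \<Rightarrow> 'a"
  rsyms  :: "'r set"
  rarity :: "'r \<Rightarrow> nat"
  rinterp :: "'r \<Rightarrow> 'a list \<Rightarrow> bool"

text \<open>
  \<open>Par a\<close> is the name of the element \<open>a\<close>; which parameters may occur is controlled by
  \<open>wf_tm\<close> and \<open>wf_fm\<close> below.
\<close>

datatype ('f, 'a) fo_tm =
  Var nat
| Par 'a
| Fn 'f "('f, 'a) fo_tm list"

datatype ('f, 'r, 'a) fo_fm =
  Eq "('f, 'a) fo_tm" "('f, 'a) fo_tm"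
| Rel 'r "('f, 'a) fo_tm list"
| Neg "('f, 'r, 'a) fo_fm"
| Conj "('f, 'r, 'a) fo_fm" "('f, 'r, 'a) fo_fm"
| Exists nat "('f, 'r, 'a) fo_fm"

fun wf_tm :: "('f, 'r, 'a) fo_struct \<Rightarrow> 'a set \<Rightarrow> ('f, 'a) fo_tm \<Rightarrow> bool" where
  "wf_tm M A (Var n) \<longleftrightarrow> True"
| "wf_tm M A (Par a) \<longleftrightarrow> a \<in> A"
| "wf_tm M A (Fn f ts) \<longleftrightarrow>
     f \<in> fsyms M \<and> length ts = farity M f \<and> (\<forall>t\<in>set ts. wf_tm M A t)"

text \<open>\<open>wf_fm M A \<phi>\<close>: \<open>\<phi>\<close> is a formula of \<open>L(A)\<close>, where \<open>L\<close> is the language of \<open>M\<close>.\<close>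

primrec wf_fm :: "('f, 'r, 'a) fo_struct \<Rightarrow> 'a set \<Rightarrow> ('f, 'r, 'a) fo_fm \<Rightarrow> bool" where
  "wf_fm M A (Eq s t) \<longleftrightarrow> wf_tm M A s \<and> wf_tm M A t"
| "wf_fm M A (Rel r ts) \<longleftrightarrow>
     r \<in> rsyms M \<and> length ts = rarity M r \<and> (\<forall>t\<in>set ts. wf_tm M A t)"
| "wf_fm M A (Neg \<phi>) \<longleftrightarrow> wf_fm M A \<phi>"
| "wf_fm M A (Conj \<phi> \<psi>) \<longleftrightarrow> wf_fm M A \<phi> \<and> wf_fm M A \<psi>"
| "wf_fm M A (Exists n \<phi>) \<longleftrightarrow> wf_fm M A \<phi>"

fun fv_tm :: "('f, 'a) fo_tm \<Rightarrow> nat set" where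
  "fv_tm (Var n) = {n}"
| "fv_tm (Par a) = {}"
| "fv_tm (Fn f ts) = (\<Union>t\<in>set ts. fv_tm t)"

primrec fv_fm :: "('f, 'r, 'a) fo_fm \<Rightarrow> nat set" where
  "fv_fm (Eq s t) = fv_tm s \<union> fv_tm t"
| "fv_fm (Rel r ts) = (\<Union>t\<in>set ts. fv_tm t)"
| "fv_fm (Neg \<phi>) = fv_fm \<phi>"
| "fv_fm (Conj \<phi> \<psi>) = fv_fm \<phi> \<union> fv_fm \<psi>"
| "fv_fm (Exists n \<phi>) = fv_fm \<phi> - {n}"

fun eval_tm :: "('f, 'r, 'a) fo_struct \<Rightarrow> (nat \<Rightarrow> 'a) \<Rightarrow> ('f, 'a) fo_tm \<Rightarrow> 'a" where
  "eval_tm M e (Var n) = e n"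
| "eval_tm M e (Par a) = a"
| "eval_tm M e (Fn f ts) = finterp M f (map (eval_tm M e) ts)"

primrec sat :: "('f, 'r, 'a) fo_struct \<Rightarrow> (nat \<Rightarrow> 'a) \<Rightarrow> ('f, 'r, 'a) fo_fm \<Rightarrow> bool" where
  "sat M e (Eq s t) \<longleftrightarrow> eval_tm M e s = eval_tm M e t"
| "sat M e (Rel r ts) \<longleftrightarrow> rinterp M r (map (eval_tm M e) ts)"
| "sat M e (Neg \<phi>) \<longleftrightarrow> \<not> sat M e \<phi>"
| "sat M e (Conj \<phi> \<psi>) \<longleftrightarrow> sat M e \<phi> \<and> sat M e \<psi>"
| "sat M e (Exists n \<phi>) \<longleftrightarrow> (\<exists>a. sat M (e(n := a)) \<phi>)"

definition formulas1 :: "('f, 'r, 'a) fo_struct \<Rightarrow> 'a set \<Rightarrow> ('f, 'r, 'a) fo_fm set" where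
  "formulas1 M A = {\<phi>. wf_fm M A \<phi> \<and> fv_fm \<phi> \<subseteq> {0}}"

text \<open>
  The solution set of a formula in the single free variable \<open>0\<close>; the other values of the
  assignment are irrelevant.
\<close>

definition solutions :: "('f, 'r, 'a) fo_struct \<Rightarrow> ('f, 'r, 'a) fo_fm \<Rightarrow> 'a set" where
  "solutions M \<phi> = {a. sat M (\<lambda>_. a) \<phi>}"

definition acl :: "('f, 'r, 'a) fo_struct \<Rightarrow> 'a set \<Rightarrow> 'a set" where
  "acl M A = {a. \<exists>\<phi>\<in>formulas1 M A. finite (solutions M \<phi>) \<and> a \<in> solutions M \<phi>}"

text \<open>
  Complete 1-types over \<open>A\<close> are sets of formulas, finitely satisfiable in \<open>M\<close> but not
  necessarily realised in \<open>M\<close>.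
\<close>

definition complete_1type ::
  "('f, 'r, 'a) fo_struct \<Rightarrow> 'a set \<Rightarrow> ('f, 'r, 'a) fo_fm set \<Rightarrow> bool" where
  "complete_1type M A p \<longleftrightarrow>
     p \<subseteq> formulas1 M A \<and>
     (\<forall>q. finite q \<and> q \<subseteq> p \<longrightarrow> (\<exists>a. \<forall>\<phi>\<in>q. a \<in> solutions M \<phi>)) \<and>
     (\<forall>\<phi>\<in>formulas1 M A. \<phi> \<in> p \<or> Neg \<phi> \<in> p)"

definition weakly_small :: "('f, 'r, 'a) fo_struct \<Rightarrow> bool" where
  "weakly_small M \<longleftrightarrow> (\<forall>A. finite A \<longrightarrow> countable {p. complete_1type M A p})"

definition has_op :: "('f, 'r, 'a) fo_struct \<Rightarrow> nat \<Rightarrow> ('a list \<Rightarrow> 'a) \<Rightarrow> bool" where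
  "has_op M n g \<longleftrightarrow>
     (\<exists>f\<in>fsyms M. farity M f = n \<and> (\<forall>xs. length xs = n \<longrightarrow> finterp M f xs = g xs))"

text \<open>
  \<open>M\<close> is the ring \<open>'a\<close>, in the language of rings, possibly with extra structure: the language
  of \<open>M\<close> contains symbols for \<open>0\<close>, \<open>1\<close>, \<open>+\<close>, \<open>-\<close>, \<open>*\<close> with their intended meaning and is
  otherwise arbitrary.
\<close>

definition expands_ring :: "('f, 'r, 'a::ring_1) fo_struct \<Rightarrow> bool" where
  "expands_ring M \<longleftrightarrow>
     has_op M 0 (\<lambda>_. 0) \<and> has_op M 0 (\<lambda>_. 1) \<and>
     has_op M 2 (\<lambda>xs. xs ! 0 + xs ! 1) \<and>
     has_op M 1 (\<lambda>xs. - (xs ! 0)) \<and>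
     has_op M 2 (\<lambda>xs. xs ! 0 * xs ! 1)"

definition centre :: "'a::ring_1 set \<Rightarrow> 'a set" where
  "centre \<Gamma> = {z \<in> \<Gamma>. \<forall>x\<in>\<Gamma>. z * x = x * z}"

text \<open>
  For \<open>\<Gamma>\<close> a division subring: the vector space \<open>\<Gamma>\<close> over the field \<open>centre \<Gamma>\<close> is spanned by a
  finite set.
\<close>

definition finite_dim_over_centre :: "'a::division_ring set \<Rightarrow> bool" where
  "finite_dim_over_centre \<Gamma> \<longleftrightarrow>
     (\<exists>B. finite B \<and> B \<subseteq> \<Gamma> \<and>
        \<Gamma> = {x. \<exists>c. (\<forall>b\<in>B. c b \<in> centre \<Gamma>) \<and> x = (\<Sum>b\<in>B. c b * b)})"

text \<open>Algebraic closures are division subrings.\<close>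

lemma eval_tm_cong:
  "(\<And>n. n \<in> fv_tm t \<Longrightarrow> e n = e' n) \<Longrightarrow> eval_tm M e t = eval_tm M e' t"
proof (induction t)
  case (Fn f ts)
  have "map (eval_tm M e) ts = map (eval_tm M e') ts"
    using Fn by auto
  then show ?case by (simp cong: map_cong)
qed auto

lemma sat_cong:
  "(\<And>n. n \<in> fv_fm \<phi> \<Longrightarrow> e n = e' n) \<Longrightarrow> sat M e \<phi> \<longleftrightarrow> sat M e' \<phi>"
proof (induction \<phi> arbitrary: e e')
  case (Eq s t)
  have "eval_tm M e s = eval_tm M e' s" "eval_tm M e t = eval_tm M e' t"
    by (rule eval_tm_cong, use Eq in simp)+
  then show ?case by simp
next
  case (Rel r ts)
  have "map (eval_tm M e) ts = map (eval_tm M e') ts"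
    using Rel by (auto intro!: eval_tm_cong)
  then show ?case by (simp cong: map_cong)
next
  case (Neg \<phi>)
  have "sat M e \<phi> \<longleftrightarrow> sat M e' \<phi>"
    by (rule Neg.IH) (use Neg.prems in simp)
  then show ?case by simp
next
  case (Conj \<phi> \<psi>)
  have "sat M e \<phi> \<longleftrightarrow> sat M e' \<phi>"
    by (rule Conj.IH(1)) (use Conj.prems in simp)
  moreover have "sat M e \<psi> \<longleftrightarrow> sat M e' \<psi>"
    by (rule Conj.IH(2)) (use Conj.prems in simp)
  ultimately show ?case by simp
next
  case (Exists n \<phi>)
  have "sat M (e(n := a)) \<phi> \<longleftrightarrow> sat M (e'(n := a)) \<phi>" for a
    by (rule Exists.IH) (use Exists.prems in auto)
  then show ?case by simp
qed

lemma sat_formulas1: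
  assumes "\<phi> \<in> formulas1 M A"
  shows "sat M e \<phi> \<longleftrightarrow> e 0 \<in> solutions M \<phi>"
proof -
  have "sat M e \<phi> \<longleftrightarrow> sat M (\<lambda>_. e 0) \<phi>"
    by (rule sat_cong) (use assms in \<open>auto simp: formulas1_def\<close>)
  then show ?thesis by (simp add: solutions_def)
qed

lemma acl_closed_under_definable:
  assumes a: "a \<in> acl M A" and b: "b \<in> acl M A"
    and \<rho>: "wf_fm M A \<rho>" "fv_fm \<rho> \<subseteq> {0, 1, 2}"
    and D: "\<And>e. sat M e \<rho> \<longleftrightarrow> D (e 0) (e 1) (e 2)"
    and fin: "\<And>y z. finite {x. D x y z}" and c: "D c a b"
  shows "c \<in> acl M A"
proof -
  obtain \<phi> where \<phi>: "\<phi> \<in> formulas1 M A" "finite (solutions M \<phi>)" "a \<in> solutions M \<phi>"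
    using a by (auto simp: acl_def)
  obtain \<psi> where \<psi>: "\<psi> \<in> formulas1 M A" "finite (solutions M \<psi>)" "b \<in> solutions M \<psi>"
    using b by (auto simp: acl_def)
  define \<chi> where "\<chi> =
    Exists 1 (Exists 2 (Conj (Exists 0 (Conj (Eq (Var 0) (Var 1)) \<phi>))
               (Conj (Exists 0 (Conj (Eq (Var 0) (Var 2)) \<psi>)) \<rho>)))"
  have "\<chi> \<in> formulas1 M A"
    using \<phi>(1) \<psi>(1) \<rho> by (auto simp: formulas1_def \<chi>_def)
  moreover have sol: "solutions M \<chi> = (\<Union>y\<in>solutions M \<phi>. \<Union>z\<in>solutions M \<psi>. {x. D x y z})"
  proof (rule set_eqI)
    fix x
    have "x \<in> solutions M \<chi> \<longleftrightarrow> sat M (\<lambda>_. x) \<chi>"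
      by (simp add: solutions_def)
    also have "\<dots> \<longleftrightarrow> (\<exists>y\<in>solutions M \<phi>. \<exists>z\<in>solutions M \<psi>. D x y z)"
      by (auto simp: \<chi>_def sat_formulas1[OF \<phi>(1)] sat_formulas1[OF \<psi>(1)] D)
    finally show "x \<in> solutions M \<chi> \<longleftrightarrow>
        x \<in> (\<Union>y\<in>solutions M \<phi>. \<Union>z\<in>solutions M \<psi>. {x. D x y z})"
      by simp
  qed
  moreover have "finite (solutions M \<chi>)"
    unfolding sol using \<phi>(2) \<psi>(2) fin by blast
  moreover have "c \<in> solutions M \<chi>"
    unfolding sol using \<phi>(3) \<psi>(3) c by blast
  ultimately show ?thesis unfolding acl_def by blast
qed

lemma acl_division_subring:
  fixes M :: "('f, 'r, 'a::division_ring) fo_struct"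
  assumes M: "expands_ring M"
  shows "A \<subseteq> acl M A" "0 \<in> acl M A" "1 \<in> acl M A"
    and "\<And>x y. x \<in> acl M A \<Longrightarrow> y \<in> acl M A \<Longrightarrow> x + y \<in> acl M A"
    and "\<And>x. x \<in> acl M A \<Longrightarrow> - x \<in> acl M A"
    and "\<And>x y. x \<in> acl M A \<Longrightarrow> y \<in> acl M A \<Longrightarrow> x * y \<in> acl M A"
    and "\<And>x. x \<in> acl M A \<Longrightarrow> inverse x \<in> acl M A"
proof -
  from M obtain zero where zero: "zero \<in> fsyms M" "farity M zero = 0"
    "\<forall>xs. length xs = 0 \<longrightarrow> finterp M zero xs = 0"
    unfolding expands_ring_def has_op_def by blast
  from M obtain one where one: "one \<in> fsyms M" "farity M one = 0"
    "\<forall>xs. length xs = 0 \<longrightarrow> finterp M one xs = 1"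
    unfolding expands_ring_def has_op_def by blast
  from M obtain add where add: "add \<in> fsyms M" "farity M add = 2"
    "\<forall>xs. length xs = 2 \<longrightarrow> finterp M add xs = xs ! 0 + xs ! 1"
    unfolding expands_ring_def has_op_def by blast
  from M obtain neg where neg: "neg \<in> fsyms M" "farity M neg = 1"
    "\<forall>xs. length xs = 1 \<longrightarrow> finterp M neg xs = - (xs ! 0)"
    unfolding expands_ring_def has_op_def by blast
  from M obtain mul where mul: "mul \<in> fsyms M" "farity M mul = 2"
    "\<forall>xs. length xs = 2 \<longrightarrow> finterp M mul xs = xs ! 0 * xs ! 1"
    unfolding expands_ring_def has_op_def by blast
  have closed_tm: "a \<in> acl M A" if "wf_tm M A t" "fv_tm t = {}" "\<And>e. eval_tm M e t = a" for a t
  proof -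
    have "Eq (Var 0) t \<in> formulas1 M A" "solutions M (Eq (Var 0) t) = {a}"
      using that by (auto simp: formulas1_def solutions_def)
    moreover from this have "finite (solutions M (Eq (Var 0) t))" "a \<in> solutions M (Eq (Var 0) t)"
      by simp_all
    ultimately show ?thesis unfolding acl_def by blast
  qed
  show "A \<subseteq> acl M A"
  proof
    fix a assume "a \<in> A"
    then show "a \<in> acl M A" by (intro closed_tm[of "Par a"]) auto
  qed
  show zero_in: "0 \<in> acl M A"
    by (rule closed_tm[of "Fn zero []"]) (use zero in auto)
  show "1 \<in> acl M A"
    by (rule closed_tm[of "Fn one []"]) (use one in auto)
  show "x + y \<in> acl M A" if "x \<in> acl M A" "y \<in> acl M A" for x y
    by (rule acl_closed_under_definable[OF that,
          of "Eq (Var 0) (Fn add [Var 1, Var 2])" "\<lambda>x y z. x = y + z"])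
       (use add in auto)
  show "x * y \<in> acl M A" if "x \<in> acl M A" "y \<in> acl M A" for x y
    by (rule acl_closed_under_definable[OF that,
          of "Eq (Var 0) (Fn mul [Var 1, Var 2])" "\<lambda>x y z. x = y * z"])
       (use mul in auto)
  show "- x \<in> acl M A" if "x \<in> acl M A" for x
    by (rule acl_closed_under_definable[OF that that,
          of "Eq (Var 0) (Fn neg [Var 1])" "\<lambda>x y z. x = - y"])
       (use neg in auto)
  show "inverse x \<in> acl M A" if "x \<in> acl M A" for x
  proof (cases "x = 0")
    case False
    show ?thesis
    proof (rule acl_closed_under_definable[OF that that,
          of "Eq (Fn mul [Var 0, Var 1]) (Fn one [])" "\<lambda>x y z. x * y = 1"])
      fix y :: 'a
      have "x = inverse y" if "x * y = 1" for x
        using inverse_unique[OF that] nonzero_inverse_inverse_eq[of x] that by force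
      then have "{x. x * y = 1} \<subseteq> {inverse y}" by blast
      then show "finite {x. x * y = 1}" by (rule finite_subset) simp
    qed (use mul one False in auto)
  qed (use zero_in in simp)
qed

end

theory Submission
  imports Defs "HOL-Computational_Algebra.Primes"
begin

text \<open>
  Write \<open>\<Gamma>\<close> for the algebraic closure of the finite set \<open>A\<close> and \<open>p\<close> for the characteristic.
  Weak smallness forbids a perfect binary tree of nonempty sets definable over a finite set
  (\<open>no_perfect_family\<close>).  This gives every definable set with parameters in \<open>\<Gamma>\<close> a rank of
  Cantor-Bendixson type.  The rank does not depend on the finite set of parameters, because an
  element of \<open>\<Gamma>\<close> has only finitely many conjugates (\<open>remove_parameter\<close>).  Instead of ordinals,
  the proof uses ideals of sets of small rank; all that is needed is that a family of
  definable sets has a member of least rank (\<open>least_rank\<close>).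

  Two facts about definable additive groups follow.  A subgroup of the same rank has finite index
  on \<open>\<Gamma>\<close> (\<open>equal_rank_finite_index\<close>), and the trace on \<open>\<Gamma>\<close> of the intersection of a definable
  family of groups is the trace of a finite subintersection (\<open>finite_subintersection\<close>).

  Applied to the multiples of the image of \<open>y \<mapsto> y ^ p - y\<close>, these facts show that infinite
  definable commutative subfields have no proper Artin-Schreier extensions
  (\<open>artin_schreier_onto\<close>).  This excludes a pair with \<open>b * u - u * b = 1\<close>
  (\<open>no_weyl_pair\<close>): such a pair yields an element \<open>w\<close> that \<open>b\<close> conjugates to \<open>w + 1\<close>, which is a
  proper Artin-Schreier extension inside the ring.

  Now let \<open>D\<close> be a centralizer of a finite subset of \<open>\<Gamma>\<close>, let \<open>b \<in> D \<inter> \<Gamma>\<close>, and let \<open>K\<close> be the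
  centralizer of \<open>b\<close> in \<open>D\<close>.  Absence of Weyl pairs makes the kernel \<open>K\<close> and the image \<open>I\<close> of the
  commutator map \<open>x \<mapsto> b * x - x * b\<close> complementary on \<open>\<Gamma>\<close>.  The projection to \<open>K\<close> defines a
  nondegenerate pairing on \<open>D \<inter> \<Gamma>\<close> with values in \<open>K\<close>, and by the chain condition finitely many
  of its functionals separate points.  So \<open>D \<inter> \<Gamma>\<close> has finite dimension over \<open>K \<inter> \<Gamma>\<close>
  (\<open>finite_dim_over_centralizer\<close>).

  Repeating this step lowers the rank each time, until \<open>\<Gamma>\<close> has finite dimension over a
  commutative division subring.  A division ring with this property has finite dimension over its
  centre (\<open>finite_dim_over_commutative_imp_centre\<close>).
\<close>

section \<open>Definable predicates, sets and relations\<close>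

text \<open>
  Definability is a property of predicates on assignments, so that closure under the logical
  operations can be applied to ordinary HOL formulas.
\<close>

definition defpred :: "('f, 'r, 'a) fo_struct \<Rightarrow> 'a set \<Rightarrow> ((nat \<Rightarrow> 'a) \<Rightarrow> bool) \<Rightarrow> bool" where
  "defpred M B P \<longleftrightarrow> (\<exists>\<phi>. wf_fm M B \<phi> \<and> (\<forall>e. sat M e \<phi> \<longleftrightarrow> P e))"

definition defterm :: "('f, 'r, 'a) fo_struct \<Rightarrow> 'a set \<Rightarrow> ((nat \<Rightarrow> 'a) \<Rightarrow> 'a) \<Rightarrow> bool" where
  "defterm M B t \<longleftrightarrow> (\<exists>s. wf_tm M B s \<and> (\<forall>e. eval_tm M e s = t e))"

abbreviation defset :: "('f, 'r, 'a) fo_struct \<Rightarrow> 'a set \<Rightarrow> 'a set \<Rightarrow> bool" where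
  "defset M B X \<equiv> defpred M B (\<lambda>e. e 0 \<in> X)"

abbreviation defrel :: "('f, 'r, 'a) fo_struct \<Rightarrow> 'a set \<Rightarrow> ('a \<Rightarrow> 'a \<Rightarrow> bool) \<Rightarrow> bool" where
  "defrel M B R \<equiv> defpred M B (\<lambda>e. R (e 0) (e 1))"

lemma finite_fv_tm: "finite (fv_tm t)"
  by (induction t) auto

lemma finite_fv_fm: "finite (fv_fm \<phi>)"
  by (induction \<phi>) (auto simp: finite_fv_tm)

lemma wf_tm_mono: "wf_tm M B t \<Longrightarrow> B \<subseteq> C \<Longrightarrow> wf_tm M C t"
  by (induction t) auto

lemma wf_fm_mono: "wf_fm M B \<phi> \<Longrightarrow> B \<subseteq> C \<Longrightarrow> wf_fm M C \<phi>"
  by (induction \<phi>) (auto intro: wf_tm_mono)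

lemma defpred_mono: "defpred M B P \<Longrightarrow> B \<subseteq> C \<Longrightarrow> defpred M C P"
  unfolding defpred_def using wf_fm_mono by blast

lemma defpred_eq:
  assumes "defterm M B s" "defterm M B t"
  shows "defpred M B (\<lambda>e. s e = t e)"
proof -
  obtain s' t' where "wf_tm M B s'" "\<forall>e. eval_tm M e s' = s e"
    "wf_tm M B t'" "\<forall>e. eval_tm M e t' = t e"
    using assms unfolding defterm_def by blast
  then show ?thesis unfolding defpred_def by (intro exI[of _ "Eq s' t'"]) auto
qed

lemma defpred_not:
  assumes "defpred M B P"
  shows "defpred M B (\<lambda>e. \<not> P e)"
proof -
  obtain \<phi> where "wf_fm M B \<phi>" "\<forall>e. sat M e \<phi> \<longleftrightarrow> P e"
    using assms unfolding defpred_def by blast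
  then show ?thesis unfolding defpred_def by (intro exI[of _ "Neg \<phi>"]) auto
qed

lemma defpred_conj:
  assumes "defpred M B P" "defpred M B Q"
  shows "defpred M B (\<lambda>e. P e \<and> Q e)"
proof -
  obtain \<phi> \<psi> where "wf_fm M B \<phi>" "\<forall>e. sat M e \<phi> \<longleftrightarrow> P e"
    "wf_fm M B \<psi>" "\<forall>e. sat M e \<psi> \<longleftrightarrow> Q e"
    using assms unfolding defpred_def by blast
  then show ?thesis unfolding defpred_def by (intro exI[of _ "Conj \<phi> \<psi>"]) auto
qed

lemma defpred_disj:
  assumes "defpred M B P" "defpred M B Q"
  shows "defpred M B (\<lambda>e. P e \<or> Q e)"
proof -
  have "defpred M B (\<lambda>e. \<not> (\<not> P e \<and> \<not> Q e))"
    by (rule defpred_not, rule defpred_conj, rule defpred_not[OF assms(1)], rule defpred_not[OF assms(2)])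
  then show ?thesis by simp
qed

lemma defpred_imp:
  assumes "defpred M B P" "defpred M B Q"
  shows "defpred M B (\<lambda>e. P e \<longrightarrow> Q e)"
proof -
  have "defpred M B (\<lambda>e. \<not> P e \<or> Q e)"
    by (rule defpred_disj, rule defpred_not[OF assms(1)], rule assms(2))
  then show ?thesis by (simp only: imp_conv_disj)
qed

lemma defpred_ex_upd:
  assumes "defpred M B P"
  shows "defpred M B (\<lambda>e. \<exists>x. P (e(n := x)))"
proof -
  obtain \<phi> where "wf_fm M B \<phi>" "\<forall>e. sat M e \<phi> \<longleftrightarrow> P e"
    using assms unfolding defpred_def by blast
  then show ?thesis unfolding defpred_def by (intro exI[of _ "Exists n \<phi>"]) auto
qed

text \<open>
  The bound variable gets the name \<open>n\<close>, which must not be in use in \<open>Q\<close>.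
\<close>

lemma defpred_ex:
  assumes "defpred M B (\<lambda>e. Q e (e n))" and "\<And>e a x. Q (e(n := a)) x = Q e x"
  shows "defpred M B (\<lambda>e. \<exists>x. Q e x)"
  using defpred_ex_upd[of M B "\<lambda>e. Q e (e n)" n, OF assms(1)] assms(2) by simp

lemma defpred_all:
  assumes "defpred M B (\<lambda>e. Q e (e n))" and "\<And>e a x. Q (e(n := a)) x = Q e x"
  shows "defpred M B (\<lambda>e. \<forall>x. Q e x)"
proof -
  have "defpred M B (\<lambda>e. \<exists>x. \<not> Q e x)"
    by (rule defpred_ex[where n = n], rule defpred_not[OF assms(1)]) (simp add: assms(2))
  then have "defpred M B (\<lambda>e. \<not> (\<exists>x. \<not> Q e x))" by (rule defpred_not)
  then show ?thesis by simp
qed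

lemma defterm_var: "defterm M B (\<lambda>e. e n)"
  unfolding defterm_def by (intro exI[of _ "Var n"]) auto

lemma defterm_par: "b \<in> B \<Longrightarrow> defterm M B (\<lambda>e. b)"
  unfolding defterm_def by (intro exI[of _ "Par b"]) auto

lemma defpred_const: "defpred M B (\<lambda>e. c)"
proof (cases c)
  case True
  have "defpred M B (\<lambda>e. e 0 = e 0)" by (intro defpred_eq defterm_var)
  then show ?thesis using True by simp
next
  case False
  have "defpred M B (\<lambda>e. e 0 \<noteq> e 0)" by (intro defpred_not defpred_eq defterm_var)
  then show ?thesis using False by simp
qed

lemmas dintros = defpred_not defpred_conj defpred_disj defpred_imp defpred_eq defpred_const
  defterm_var defterm_par

lemma defpred_ball_finite:
  assumes "finite S" "\<And>s. s \<in> S \<Longrightarrow> defpred M B (\<lambda>e. P e s)"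
  shows "defpred M B (\<lambda>e. \<forall>s\<in>S. P e s)"
  using assms by (induction S) (auto simp: defpred_const intro: defpred_conj)

text \<open>
  Free variables on which a predicate does not depend can be quantified away.
\<close>

lemma defpred_fv:
  assumes "defpred M B P" and V: "\<And>e e'. (\<And>n. n \<in> V \<Longrightarrow> e n = e' n) \<Longrightarrow> P e \<longleftrightarrow> P e'"
  shows "\<exists>\<phi>. wf_fm M B \<phi> \<and> fv_fm \<phi> \<subseteq> V \<and> (\<forall>e. sat M e \<phi> \<longleftrightarrow> P e)"
proof -
  obtain \<phi> where \<phi>: "wf_fm M B \<phi>" "\<forall>e. sat M e \<phi> \<longleftrightarrow> P e"
    using assms(1) unfolding defpred_def by blast
  have "\<exists>\<psi>. wf_fm M B \<psi> \<and> fv_fm \<psi> \<subseteq> fv_fm \<phi> - W \<and> (\<forall>e. sat M e \<psi> \<longleftrightarrow> P e)"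
    if "finite W" "W \<inter> V = {}" for W
    using that
  proof (induction W)
    case empty
    then show ?case using \<phi> by blast
  next
    case (insert n W)
    then obtain \<psi> where \<psi>: "wf_fm M B \<psi>" "fv_fm \<psi> \<subseteq> fv_fm \<phi> - W" "\<forall>e. sat M e \<psi> \<longleftrightarrow> P e"
      by auto
    have "P (e(n := a)) = P e" for e a
      by (rule V) (use insert in auto)
    then show ?case using \<psi> by (intro exI[of _ "Exists n \<psi>"]) auto
  qed
  moreover have "finite (fv_fm \<phi> - V)" by (simp add: finite_fv_fm)
  ultimately obtain \<psi> where "wf_fm M B \<psi>" "fv_fm \<psi> \<subseteq> fv_fm \<phi> - (fv_fm \<phi> - V)"
    "\<forall>e. sat M e \<psi> \<longleftrightarrow> P e"
    by (metis Diff_disjoint inf_commute)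
  then show ?thesis by (intro exI[of _ \<psi>]) auto
qed

lemma defset_iff_formula:
  "defset M B X \<longleftrightarrow> (\<exists>\<phi>\<in>formulas1 M B. solutions M \<phi> = X)"
proof
  assume "defset M B X"
  then obtain \<phi> where "wf_fm M B \<phi>" "fv_fm \<phi> \<subseteq> {0}" "\<forall>e. sat M e \<phi> \<longleftrightarrow> e 0 \<in> X"
    using defpred_fv[of M B "\<lambda>e. e 0 \<in> X" "{0}"] by (metis insertI1)
  then show "\<exists>\<phi>\<in>formulas1 M B. solutions M \<phi> = X"
    by (intro bexI[of _ \<phi>]) (auto simp: formulas1_def solutions_def)
next
  assume "\<exists>\<phi>\<in>formulas1 M B. solutions M \<phi> = X"
  then obtain \<phi> where \<phi>: "\<phi> \<in> formulas1 M B" "solutions M \<phi> = X" by blast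
  then show "defset M B X"
    unfolding defpred_def using sat_formulas1[OF \<phi>(1)]
    by (intro exI[of _ \<phi>]) (simp add: formulas1_def)
qed

lemma acl_iff_defset: "a \<in> acl M B \<longleftrightarrow> (\<exists>X. finite X \<and> defset M B X \<and> a \<in> X)"
  unfolding acl_def defset_iff_formula by auto

lemma defterm_fresh:
  assumes "defterm M B t"
  shows "\<exists>N. \<forall>n\<ge>N. \<forall>e a. t (e(n := a)) = t e"
proof -
  obtain s where s: "\<forall>e. eval_tm M e s = t e"
    using assms unfolding defterm_def by blast
  obtain N where N: "\<forall>n\<in>fv_tm s. n < N"
    using finite_fv_tm[of s] unfolding finite_nat_set_iff_bounded by metis
  have "t (e(n := a)) = t e" if "n \<ge> N" for n e a
    using eval_tm_cong[of s "e(n := a)" e M] s N that by fastforce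
  then show ?thesis by blast
qed

lemma defpred_mem:
  assumes X: "defset M B X" and t: "defterm M B t"
  shows "defpred M B (\<lambda>e. t e \<in> X)"
proof -
  obtain N where N: "\<And>n e a. n \<ge> N \<Longrightarrow> t (e(n := a)) = t e"
    using defterm_fresh[OF t] by metis
  define n where "n = Suc N"
  have "defpred M B (\<lambda>e. \<exists>x. x = e n \<and> x \<in> X)"
    by (rule defpred_ex[where n = 0]) (intro dintros X, simp add: n_def)
  then have "defpred M B (\<lambda>e. e n \<in> X)" by simp
  then have "defpred M B (\<lambda>e. \<exists>x. x = t e \<and> x \<in> X)"
    by (intro defpred_ex[where n = n] dintros t) (simp_all add: n_def N)
  then show ?thesis by simp
qed

lemma defpred_rel:
  assumes R: "defrel M B R" and s: "defterm M B s" and t: "defterm M B t"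
  shows "defpred M B (\<lambda>e. R (s e) (t e))"
proof -
  obtain N1 where N1: "\<And>n e a. n \<ge> N1 \<Longrightarrow> s (e(n := a)) = s e"
    using defterm_fresh[OF s] by metis
  obtain N2 where N2: "\<And>n e a. n \<ge> N2 \<Longrightarrow> t (e(n := a)) = t e"
    using defterm_fresh[OF t] by metis
  define n where "n = N1 + N2 + 2"
  \<comment> \<open>Rename the variables of \<open>R\<close> to fresh ones, which are then free to be bound.\<close>
  have "defpred M B (\<lambda>e. \<exists>y. y = e (Suc n) \<and> R (e 0) y)"
    by (rule defpred_ex[where n = 1]) (intro dintros R, simp add: n_def)
  then have "defpred M B (\<lambda>e. R (e 0) (e (Suc n)))" by simp
  then have "defpred M B (\<lambda>e. \<exists>x. x = e n \<and> R x (e (Suc n)))"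
    by (intro defpred_ex[where n = 0] dintros) (simp_all add: n_def)
  then have "defpred M B (\<lambda>e. R (e n) (e (Suc n)))" by simp
  then have "defpred M B (\<lambda>e. \<exists>y. y = t e \<and> R (e n) y)"
    by (intro defpred_ex[where n = "Suc n"] dintros t) (simp_all add: n_def N2)
  then have "defpred M B (\<lambda>e. R (e n) (t e))" by simp
  then have "defpred M B (\<lambda>e. \<exists>x. x = s e \<and> R x (t e))"
    by (intro defpred_ex[where n = n] dintros s) (simp_all add: n_def N1 N2)
  then show ?thesis by simp
qed

lemma defset_Int: "defset M B X \<Longrightarrow> defset M B Y \<Longrightarrow> defset M B (X \<inter> Y)"
  using defpred_conj[of M B "\<lambda>e. e 0 \<in> X" "\<lambda>e. e 0 \<in> Y"] by simp

lemma defset_Un: "defset M B X \<Longrightarrow> defset M B Y \<Longrightarrow> defset M B (X \<union> Y)"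
  using defpred_disj[of M B "\<lambda>e. e 0 \<in> X" "\<lambda>e. e 0 \<in> Y"] by simp

lemma defset_Diff: "defset M B X \<Longrightarrow> defset M B Y \<Longrightarrow> defset M B (X - Y)"
  using defpred_conj[of M B "\<lambda>e. e 0 \<in> X" "\<lambda>e. e 0 \<notin> Y"] by (simp add: defpred_not)

lemma defset_UN_finite:
  assumes "finite I" "\<And>i. i \<in> I \<Longrightarrow> defset M B (X i)"
  shows "defset M B (\<Union>i\<in>I. X i)"
  using assms by (induction I) (auto simp: defpred_const intro: defset_Un defpred_disj)

lemma defset_finite: "finite X \<Longrightarrow> X \<subseteq> B \<Longrightarrow> defset M B X"
proof (induction X rule: finite_induct)
  case (insert x X)
  then have "defpred M B (\<lambda>e. e 0 = x \<or> e 0 \<in> X)" by (intro dintros) auto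
  then show ?case by simp
qed (simp add: defpred_const)

lemma defset_slice: "defrel M B R \<Longrightarrow> b \<in> B \<Longrightarrow> defset M B {x. R x b}"
  using defpred_rel[of M B R "\<lambda>e. e 0" "\<lambda>e. b"] by (simp add: dintros)

lemma defset_image:
  assumes "defrel M B (\<lambda>x y. y = f x)" "defset M B X"
  shows "defset M B (f ` X)"
proof -
  have "defpred M B (\<lambda>e. \<exists>x. x \<in> X \<and> e 0 = f x)"
    by (rule defpred_ex[where n = 1])
       (intro dintros defpred_mem[OF assms(2)] defpred_rel[OF assms(1)], simp)
  then show ?thesis by (simp add: image_iff Bex_def)
qed

lemma finite_params:
  assumes "defpred M B P"
  obtains C where "finite C" "C \<subseteq> B" "defpred M C P"
proof -
  have tm: "\<exists>C. finite C \<and> C \<subseteq> B \<and> wf_tm M C t" if "wf_tm M B t" for t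
    using that
  proof (induction t)
    case (Var n)
    show ?case by (intro exI[of _ "{}"]) simp
  next
    case (Par a)
    then show ?case by (intro exI[of _ "{a}"]) simp
  next
    case (Fn f ts)
    then have "\<forall>t\<in>set ts. \<exists>C. finite C \<and> C \<subseteq> B \<and> wf_tm M C t" by auto
    then obtain C where "\<forall>t\<in>set ts. finite (C t) \<and> C t \<subseteq> B \<and> wf_tm M (C t) t"
      by metis
    then show ?case using Fn.prems
      by (intro exI[of _ "\<Union>t\<in>set ts. C t"]) (auto intro: wf_tm_mono)
  qed
  have fm: "\<exists>C. finite C \<and> C \<subseteq> B \<and> wf_fm M C \<phi>" if "wf_fm M B \<phi>" for \<phi>
    using that
  proof (induction \<phi>)
    case (Eq s t)
    then obtain C D where "finite C" "C \<subseteq> B" "wf_tm M C s" "finite D" "D \<subseteq> B" "wf_tm M D t"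
      using tm by (metis wf_fm.simps(1))
    then show ?case by (intro exI[of _ "C \<union> D"]) (auto intro: wf_tm_mono)
  next
    case (Rel r ts)
    then have "\<forall>t\<in>set ts. \<exists>C. finite C \<and> C \<subseteq> B \<and> wf_tm M C t" using tm by auto
    then obtain C where "\<forall>t\<in>set ts. finite (C t) \<and> C t \<subseteq> B \<and> wf_tm M (C t) t"
      by metis
    then show ?case using Rel.prems
      by (intro exI[of _ "\<Union>t\<in>set ts. C t"]) (auto intro: wf_tm_mono)
  next
    case (Conj \<phi> \<psi>)
    then obtain C D where "finite C" "C \<subseteq> B" "wf_fm M C \<phi>" "finite D" "D \<subseteq> B" "wf_fm M D \<psi>"
      by auto
    then show ?case by (intro exI[of _ "C \<union> D"]) (auto intro: wf_fm_mono)
  qed simp_all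
  show ?thesis using assms fm that unfolding defpred_def by metis
qed

text \<open>
  A set that is definable with the extra parameter \<open>b\<close> is a fibre over \<open>b\<close> of a relation that is
  definable without it: replace \<open>b\<close> by a variable that occurs nowhere in the formula.
\<close>

primrec unpar_tm :: "'a \<Rightarrow> nat \<Rightarrow> ('f, 'a) fo_tm \<Rightarrow> ('f, 'a) fo_tm" where
  "unpar_tm b n (Var m) = Var m"
| "unpar_tm b n (Par a) = (if a = b then Var n else Par a)"
| "unpar_tm b n (Fn f ts) = Fn f (map (unpar_tm b n) ts)"

primrec unpar_fm :: "'a \<Rightarrow> nat \<Rightarrow> ('f, 'r, 'a) fo_fm \<Rightarrow> ('f, 'r, 'a) fo_fm" where
  "unpar_fm b n (Eq s t) = Eq (unpar_tm b n s) (unpar_tm b n t)"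
| "unpar_fm b n (Rel r ts) = Rel r (map (unpar_tm b n) ts)"
| "unpar_fm b n (Neg \<phi>) = Neg (unpar_fm b n \<phi>)"
| "unpar_fm b n (Conj \<phi> \<psi>) = Conj (unpar_fm b n \<phi>) (unpar_fm b n \<psi>)"
| "unpar_fm b n (Exists m \<phi>) = Exists m (unpar_fm b n \<phi>)"

primrec bound_vars :: "('f, 'r, 'a) fo_fm \<Rightarrow> nat set" where
  "bound_vars (Eq s t) = {}"
| "bound_vars (Rel r ts) = {}"
| "bound_vars (Neg \<phi>) = bound_vars \<phi>"
| "bound_vars (Conj \<phi> \<psi>) = bound_vars \<phi> \<union> bound_vars \<psi>"
| "bound_vars (Exists m \<phi>) = insert m (bound_vars \<phi>)"

lemma wf_unpar_tm: "wf_tm M (insert b B) t \<Longrightarrow> wf_tm M B (unpar_tm b n t)"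
  by (induction t) auto

lemma wf_unpar_fm: "wf_fm M (insert b B) \<phi> \<Longrightarrow> wf_fm M B (unpar_fm b n \<phi>)"
  by (induction \<phi>) (auto simp: wf_unpar_tm)

lemma fv_unpar_tm: "fv_tm (unpar_tm b n t) \<subseteq> insert n (fv_tm t)"
  by (induction t) auto

lemma fv_unpar_fm: "fv_fm (unpar_fm b n \<phi>) \<subseteq> insert n (fv_fm \<phi>)"
  by (induction \<phi>) (use fv_unpar_tm in fastforce)+

lemma eval_unpar_tm: "e n = b \<Longrightarrow> eval_tm M e (unpar_tm b n t) = eval_tm M e t"
  by (induction t) (auto simp: comp_def cong: map_cong)

lemma sat_unpar_fm:
  "e n = b \<Longrightarrow> n \<notin> bound_vars \<phi> \<Longrightarrow> sat M e (unpar_fm b n \<phi>) \<longleftrightarrow> sat M e \<phi>"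
  by (induction \<phi> arbitrary: e) (auto simp: eval_unpar_tm comp_def)

lemma finite_bound_vars: "finite (bound_vars \<phi>)"
  by (induction \<phi>) auto

lemma defset_insert_param:
  assumes "defset M (insert b B) X"
  shows "\<exists>R. defrel M B R \<and> X = {x. R x b}"
proof -
  obtain \<phi> where "\<phi> \<in> formulas1 M (insert b B)" and X: "solutions M \<phi> = X"
    using assms unfolding defset_iff_formula by blast
  then have \<phi>: "wf_fm M (insert b B) \<phi>" "fv_fm \<phi> \<subseteq> {0}" and sat: "\<And>e. sat M e \<phi> \<longleftrightarrow> e 0 \<in> X"
    using sat_formulas1[of \<phi>] by (auto simp: formulas1_def)
  have "finite (bound_vars \<phi> \<union> {0, 1})" by (simp add: finite_bound_vars)
  then obtain n where n: "n \<notin> bound_vars \<phi>" "n \<noteq> 0" "n \<noteq> 1"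
    using ex_new_if_finite[OF infinite_UNIV_nat] by (metis UnCI insertCI)
  define P where "P e = sat M e (unpar_fm b n \<phi>)" for e
  have P: "P e \<longleftrightarrow> P e'" if "e 0 = e' 0" "e n = e' n" for e e'
    unfolding P_def by (rule sat_cong) (use that fv_unpar_fm[of b n \<phi>] \<phi>(2) in auto)
  define R where "R x y = P ((\<lambda>_. x)(n := y))" for x y
  have "defpred M B P"
    unfolding defpred_def P_def using wf_unpar_fm[OF \<phi>(1)]
    by (intro exI[of _ "unpar_fm b n \<phi>"]) simp
  moreover have "R (e 0) (e n) = P e" for e
    unfolding R_def by (rule P) (use n in auto)
  ultimately have "defpred M B (\<lambda>e. R (e 0) (e n))" by simp
  then have "defpred M B (\<lambda>e. \<exists>y. y = e 1 \<and> R (e 0) y)"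
    by (intro defpred_ex[where n = n] dintros) (use n in auto)
  then have "defrel M B R" by simp
  moreover have "R x b \<longleftrightarrow> x \<in> X" for x
    using sat_unpar_fm[of "(\<lambda>_. x)(n := b)" n b \<phi> M] n sat by (auto simp: R_def P_def)
  ultimately show ?thesis by (intro exI[of _ R]) (simp add: set_eq_iff)
qed

text \<open>
  An algebraic element lies in a smallest definable set: among the finite definable sets that
  contain it, take one with the least number of elements.  Its elements are the conjugates of the
  given one, and every definable property passes from the element to all of them.
\<close>

lemma algebraic_atom:
  assumes "b \<in> acl M B"
  obtains O' where "finite O'" "b \<in> O'" "defset M B O'" "\<And>X. defset M B X \<Longrightarrow> b \<in> X \<Longrightarrow> O' \<subseteq> X"
proof -
  let ?P = "\<lambda>X. finite X \<and> defset M B X \<and> b \<in> X"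
  obtain X0 where "?P X0" using assms unfolding acl_iff_defset by metis
  then obtain O' where O': "?P O'" and le: "\<And>X. ?P X \<Longrightarrow> card O' \<le> card X"
    using ex_has_least_nat[of ?P X0 card] by metis
  have "O' \<subseteq> X" if "defset M B X" "b \<in> X" for X
  proof -
    have "?P (O' \<inter> X)" using O' that(2) defset_Int[OF _ that(1), of O'] by simp
    then have "card O' \<le> card (O' \<inter> X)" by (rule le)
    then have "O' \<inter> X = O'" using O' by (intro card_seteq) simp_all
    then show ?thesis by blast
  qed
  with that[of O'] O' show ?thesis by simp
qed

lemma acl_mono:
  assumes "B \<subseteq> C"
  shows "acl M B \<subseteq> acl M C"
proof
  fix a assume "a \<in> acl M B"
  then obtain X where "finite X" "defset M B X" "a \<in> X" unfolding acl_iff_defset by auto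
  then show "a \<in> acl M C"
    unfolding acl_iff_defset using defpred_mono[OF _ assms] by (intro exI[of _ X]) simp
qed

section \<open>Weak smallness\<close>

text \<open>
  A maximal finitely satisfiable set of formulas is complete: if neither a formula nor its
  negation could be added, two finite parts of the set would exclude both.
\<close>

lemma extend_to_type:
  assumes q: "q \<subseteq> formulas1 M B"
    and sat: "\<And>r. finite r \<Longrightarrow> r \<subseteq> q \<Longrightarrow> \<exists>a. \<forall>\<phi>\<in>r. a \<in> solutions M \<phi>"
  obtains p where "complete_1type M B p" "q \<subseteq> p"
proof -
  let ?fs = "\<lambda>p. \<forall>r. finite r \<and> r \<subseteq> p \<longrightarrow> (\<exists>a. \<forall>\<phi>\<in>r. a \<in> solutions M \<phi>)"
  define \<A> where "\<A> = {p. q \<subseteq> p \<and> p \<subseteq> formulas1 M B \<and> ?fs p}"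
  have "\<exists>p\<in>\<A>. \<forall>X\<in>\<A>. p \<subseteq> X \<longrightarrow> X = p"
  proof (rule subset_Zorn_nonempty)
    have "q \<in> \<A>" unfolding \<A>_def using q sat by simp
    then show "\<A> \<noteq> {}" by blast
    fix \<C> assume \<C>: "\<C> \<noteq> {}" "subset.chain \<A> \<C>"
    then have sub: "\<C> \<subseteq> \<A>" by (simp add: subset.chain_def)
    have "?fs (\<Union>\<C>)"
    proof (intro allI impI)
      fix r assume r: "finite r \<and> r \<subseteq> \<Union>\<C>"
      then obtain c where "c \<in> \<C>" "r \<subseteq> c"
        using finite_subset_Union_chain[of r \<C> \<A>] \<C> by metis
      moreover from this have "c \<in> \<A>" using sub by blast
      ultimately show "\<exists>a. \<forall>\<phi>\<in>r. a \<in> solutions M \<phi>" using r by (simp add: \<A>_def)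
    qed
    moreover have mem: "q \<subseteq> c \<and> c \<subseteq> formulas1 M B" if "c \<in> \<C>" for c
      using subsetD[OF sub that] unfolding \<A>_def by simp
    have "q \<subseteq> \<Union>\<C>" using \<C>(1) mem by blast
    moreover have "\<Union>\<C> \<subseteq> formulas1 M B" using mem by blast
    ultimately show "\<Union>\<C> \<in> \<A>" unfolding \<A>_def by simp
  qed
  then obtain p where p: "p \<in> \<A>" and max: "\<And>X. X \<in> \<A> \<Longrightarrow> p \<subseteq> X \<Longrightarrow> X = p"
    by blast
  have "\<phi> \<in> p \<or> Neg \<phi> \<in> p" if \<phi>: "\<phi> \<in> formulas1 M B" for \<phi>
  proof (rule ccontr)
    assume no: "\<not> (\<phi> \<in> p \<or> Neg \<phi> \<in> p)"
    have bad: "\<exists>r. finite r \<and> r \<subseteq> p \<and> (\<forall>a. (\<forall>\<chi>\<in>r. a \<in> solutions M \<chi>) \<longrightarrow> a \<notin> solutions M \<psi>)"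
      if "\<psi> \<notin> p" "\<psi> \<in> formulas1 M B" for \<psi>
    proof -
      have "insert \<psi> p \<notin> \<A>" using max[of "insert \<psi> p"] that(1) by auto
      then have "\<not> ?fs (insert \<psi> p)" using p that(2) by (simp add: \<A>_def subset_insertI2)
      then obtain r where r: "finite r" "r \<subseteq> insert \<psi> p" "\<not> (\<exists>a. \<forall>\<phi>\<in>r. a \<in> solutions M \<phi>)"
        by metis
      then show ?thesis by (intro exI[of _ "r - {\<psi>}"]) auto
    qed
    have neg: "Neg \<phi> \<in> formulas1 M B" using \<phi> by (auto simp: formulas1_def)
    obtain r where r: "finite r" "r \<subseteq> p"
      "\<And>a. (\<forall>\<chi>\<in>r. a \<in> solutions M \<chi>) \<Longrightarrow> a \<notin> solutions M \<phi>"
      using bad[of \<phi>] no \<phi> by metis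
    obtain r' where r': "finite r'" "r' \<subseteq> p"
      "\<And>a. (\<forall>\<chi>\<in>r'. a \<in> solutions M \<chi>) \<Longrightarrow> a \<notin> solutions M (Neg \<phi>)"
      using bad[of "Neg \<phi>"] no neg by metis
    have "?fs p" using p by (simp add: \<A>_def)
    then obtain a where "\<forall>\<chi>\<in>r \<union> r'. a \<in> solutions M \<chi>"
      using r(1,2) r'(1,2) by (metis finite_UnI Un_least)
    then show False using r(3)[of a] r'(3)[of a] by (simp add: solutions_def)
  qed
  then have "complete_1type M B p" using p by (simp add: complete_1type_def \<A>_def)
  then show ?thesis using that p by (simp add: \<A>_def)
qed

text \<open>
  A binary tree of nonempty definable sets has continuum many branches, and each of them yields a
  complete type.
\<close>

lemma no_perfect_family:
  assumes small: "weakly_small M" "finite B"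
    and P: "\<And>X. X \<in> P \<Longrightarrow> defset M B X \<and> X \<noteq> {}"
    and split: "\<And>X. X \<in> P \<Longrightarrow> \<exists>Y\<in>P. \<exists>Z\<in>P. Y \<subseteq> X \<and> Z \<subseteq> X \<and> Y \<inter> Z = {}"
  shows "P = {}"
proof (rule ccontr)
  assume "P \<noteq> {}"
  then obtain X0 where X0: "X0 \<in> P" by blast
  obtain f where f: "\<And>X i. X \<in> P \<Longrightarrow> f X i \<in> P \<and> f X i \<subseteq> X" "\<And>X. X \<in> P \<Longrightarrow> f X True \<inter> f X False = {}"
  proof -
    obtain g h where "\<And>X. X \<in> P \<Longrightarrow> g X \<in> P \<and> h X \<in> P \<and> g X \<subseteq> X \<and> h X \<subseteq> X \<and> g X \<inter> h X = {}"
      using split by metis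
    then show ?thesis by (intro that[of "\<lambda>X i. if i then g X else h X"]) auto
  qed
  define T where "T \<sigma> n = rec_nat X0 (\<lambda>k X. f X (k \<in> \<sigma>)) n" for \<sigma> :: "nat set" and n
  have T_0: "T \<sigma> 0 = X0" for \<sigma> by (simp add: T_def)
  have T_Suc: "T \<sigma> (Suc n) = f (T \<sigma> n) (n \<in> \<sigma>)" for \<sigma> n by (simp add: T_def)
  have TP: "T \<sigma> n \<in> P" for \<sigma> n
    by (induction n) (use X0 f(1) in \<open>auto simp: T_0 T_Suc\<close>)
  have anti: "T \<sigma> n \<subseteq> T \<sigma> m" if "m \<le> n" for \<sigma> m n
    by (rule lift_Suc_antimono_le[of "T \<sigma>"]) (use that f(1) TP in \<open>auto simp: T_Suc\<close>)
  define q where "q \<sigma> = {\<phi>\<in>formulas1 M B. \<exists>n. T \<sigma> n \<subseteq> solutions M \<phi>}" for \<sigma>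
  have "\<exists>p. complete_1type M B p \<and> q \<sigma> \<subseteq> p" for \<sigma>
  proof (rule extend_to_type)
    show "q \<sigma> \<subseteq> formulas1 M B" by (auto simp: q_def)
    fix r assume r: "finite r" "r \<subseteq> q \<sigma>"
    then have "\<forall>\<phi>\<in>r. \<exists>n. T \<sigma> n \<subseteq> solutions M \<phi>" by (auto simp: q_def)
    then obtain N where N: "\<And>\<phi>. \<phi> \<in> r \<Longrightarrow> T \<sigma> (N \<phi>) \<subseteq> solutions M \<phi>" by metis
    obtain k where k: "\<forall>\<phi>\<in>r. N \<phi> \<le> k"
      using finite_nat_set_iff_bounded_le[of "N ` r"] r(1) by auto
    obtain a where "a \<in> T \<sigma> k" using TP P by blast
    then show "\<exists>a. \<forall>\<phi>\<in>r. a \<in> solutions M \<phi>"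
      using anti N k by (intro exI[of _ a]) blast
  qed blast
  then obtain p where p: "\<And>\<sigma>. complete_1type M B (p \<sigma>)" "\<And>\<sigma>. q \<sigma> \<subseteq> p \<sigma>" by metis
  have "inj p"
  proof (rule injI, rule ccontr)
    fix \<sigma> \<tau> assume eq: "p \<sigma> = p \<tau>" and "\<sigma> \<noteq> \<tau>"
    then have "\<exists>n. (n \<in> \<sigma>) \<noteq> (n \<in> \<tau>)" by blast
    then obtain n where n: "(n \<in> \<sigma>) \<noteq> (n \<in> \<tau>)" and min: "\<forall>m<n. (m \<in> \<sigma>) = (m \<in> \<tau>)"
      using exists_least_iff[of "\<lambda>n. (n \<in> \<sigma>) \<noteq> (n \<in> \<tau>)"] by blast
    have "m \<le> n \<Longrightarrow> T \<sigma> m = T \<tau> m" for m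
      by (induction m) (use min in \<open>auto simp: T_0 T_Suc\<close>)
    then have disj: "T \<sigma> (Suc n) \<inter> T \<tau> (Suc n) = {}"
      using f(2)[OF TP[of \<tau> n]] n by (cases "n \<in> \<sigma>") (auto simp: T_Suc)
    obtain \<phi> \<psi> where "\<phi> \<in> formulas1 M B" "solutions M \<phi> = T \<sigma> (Suc n)"
      "\<psi> \<in> formulas1 M B" "solutions M \<psi> = T \<tau> (Suc n)"
      using P[OF TP] unfolding defset_iff_formula by metis
    then have "\<phi> \<in> q \<sigma>" "\<psi> \<in> q \<tau>" "solutions M \<phi> \<inter> solutions M \<psi> = {}"
      using disj unfolding q_def by blast+
    then have "\<phi> \<in> p \<sigma>" "\<psi> \<in> p \<sigma>" "solutions M \<phi> \<inter> solutions M \<psi> = {}"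
      using p(2)[of \<sigma>] p(2)[of \<tau>] eq by auto
    moreover have "\<exists>a. \<forall>\<chi>\<in>{\<phi>, \<psi>}. a \<in> solutions M \<chi>"
      if "\<phi> \<in> p \<sigma>" "\<psi> \<in> p \<sigma>"
    proof -
      have "\<forall>r. finite r \<and> r \<subseteq> p \<sigma> \<longrightarrow> (\<exists>a. \<forall>\<chi>\<in>r. a \<in> solutions M \<chi>)"
        using p(1)[of \<sigma>] by (simp add: complete_1type_def)
      from this[rule_format, of "{\<phi>, \<psi>}"] show ?thesis using that by simp
    qed
    ultimately show False by (metis disjoint_iff insertI1 insert_commute)
  qed
  moreover have "countable (range p)"
  proof (rule countable_subset)
    show "range p \<subseteq> {p. complete_1type M B p}" using p(1) by auto
    show "countable {p. complete_1type M B p}" using small by (simp add: weakly_small_def)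
  qed
  ultimately have "countable (UNIV :: nat set set)"
    using countable_image_inj_eq by blast
  then have "range (from_nat_into (UNIV :: nat set set)) = Pow UNIV"
    using range_from_nat_into[of "UNIV :: nat set set"] by simp
  then show False using Cantors_theorem[of "UNIV :: nat set"] by blast
qed

section \<open>Ideals of sets of small rank\<close>

locale small_closure =
  fixes M :: "('f, 'r, 'a) fo_struct" and A :: "'a set"
  assumes small: "weakly_small M" and finite_A: "finite A"
begin

definition \<Gamma> :: "'a set" where "\<Gamma> = acl M A"

definition base :: "'a set \<Rightarrow> bool" where
  "base C \<longleftrightarrow> finite C \<and> A \<subseteq> C \<and> C \<subseteq> \<Gamma>"

lemma A_sub: "A \<subseteq> \<Gamma>"
proof
  fix a assume "a \<in> A"
  then have "defset M A {a}" by (intro defset_finite) auto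
  then show "a \<in> \<Gamma>" unfolding \<Gamma>_def acl_iff_defset by (intro exI[of _ "{a}"]) simp
qed

lemma base_A: "base A"
  using finite_A A_sub by (simp add: base_def)

lemma base_defpred:
  assumes "base C" "defpred M C P"
  shows "defpred M \<Gamma> P"
  using assms(2) by (rule defpred_mono) (use assms(1) in \<open>simp add: base_def\<close>)

lemma extend_base:
  assumes "base C" "defpred M \<Gamma> P"
  obtains C' where "base C'" "C \<subseteq> C'" "defpred M C' P"
proof -
  obtain C0 where "finite C0" "C0 \<subseteq> \<Gamma>" "defpred M C0 P"
    using assms(2) by (rule finite_params)
  moreover from this(3) have "defpred M (C \<union> C0) P" by (rule defpred_mono) simp
  ultimately show ?thesis using assms(1) that[of "C \<union> C0"] by (auto simp: base_def)
qed

text \<open>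
  The atom of an element of \<open>\<Gamma>\<close> over any base stays inside \<open>\<Gamma>\<close>, because it refines the atom
  over \<open>A\<close>.
\<close>

lemma conjugates:
  assumes "base C" "b \<in> \<Gamma>"
  obtains O' where "finite O'" "b \<in> O'" "O' \<subseteq> \<Gamma>" "defset M C O'"
    "\<And>X. defset M C X \<Longrightarrow> b \<in> X \<Longrightarrow> O' \<subseteq> X"
proof -
  have AC: "A \<subseteq> C" using assms(1) by (simp add: base_def)
  have "b \<in> acl M C" using assms(2) acl_mono[OF AC, of M] by (auto simp: \<Gamma>_def)
  then obtain O' where O': "finite O'" "b \<in> O'" "defset M C O'"
    and min: "\<And>X. defset M C X \<Longrightarrow> b \<in> X \<Longrightarrow> O' \<subseteq> X"
    using algebraic_atom by metis
  obtain X where X: "finite X" "defset M A X" "b \<in> X"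
    using assms(2) unfolding \<Gamma>_def acl_iff_defset by auto
  have "x \<in> \<Gamma>" if "x \<in> X" for x
    unfolding \<Gamma>_def acl_iff_defset using X that by (intro exI[of _ X]) simp
  then have "X \<subseteq> \<Gamma>" by blast
  moreover have "O' \<subseteq> X" using defpred_mono[OF X(2) AC] X(3) by (rule min)
  ultimately show ?thesis using that[of O'] O' min by simp
qed

definition large_family :: "'a set \<Rightarrow> 'a set set \<Rightarrow> 'a set \<Rightarrow> (nat \<Rightarrow> 'a set) \<Rightarrow> bool" where
  "large_family C J X Y \<longleftrightarrow>
     (\<forall>i. defset M C (Y i) \<and> Y i \<subseteq> X \<and> Y i \<notin> J) \<and> (\<forall>i j. i \<noteq> j \<longrightarrow> Y i \<inter> Y j = {})"

text \<open>
  For an ideal \<open>J\<close>, thought of as the sets of rank less than some ordinal, \<open>derived J\<close> consists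
  of the sets of at most that rank.  The parameters of a family of subsets must come from one
  finite subset of \<open>\<Gamma>\<close>: only over finite sets are there few types.
\<close>

definition derived :: "'a set set \<Rightarrow> 'a set set" where
  "derived J = {X. defset M \<Gamma> X \<and> (\<forall>C Y. base C \<longrightarrow> \<not> large_family C J X Y)}"

text \<open>
  The last clause expresses that a definable map with fibres of bounded size does not lower the
  rank.  It covers translations, Artin-Schreier maps and injective derivations.
\<close>

definition rank_ideal :: "'a set set \<Rightarrow> bool" where
  "rank_ideal J \<longleftrightarrow>
     {} \<in> J \<and> (\<forall>X\<in>J. defset M \<Gamma> X) \<and>
     (\<forall>X\<in>J. \<forall>Y. defset M \<Gamma> Y \<and> Y \<subseteq> X \<longrightarrow> Y \<in> J) \<and>
     (\<forall>X\<in>J. \<forall>Y\<in>J. X \<union> Y \<in> J) \<and>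
     (\<forall>f X k. defrel M \<Gamma> (\<lambda>x y. y = f x) \<and> defset M \<Gamma> X \<and>
        (\<forall>y. finite {x\<in>X. f x = y} \<and> card {x\<in>X. f x = y} \<le> k) \<and> f ` X \<in> J \<longrightarrow> X \<in> J)"

lemma
  assumes "rank_ideal J"
  shows ideal_empty: "{} \<in> J"
    and ideal_def: "X \<in> J \<Longrightarrow> defset M \<Gamma> X"
    and ideal_sub: "X \<in> J \<Longrightarrow> defset M \<Gamma> Y \<Longrightarrow> Y \<subseteq> X \<Longrightarrow> Y \<in> J"
    and ideal_Un: "X \<in> J \<Longrightarrow> Y \<in> J \<Longrightarrow> X \<union> Y \<in> J"
  using assms unfolding rank_ideal_def by blast+

lemma ideal_fibres:
  assumes "rank_ideal J" "defrel M \<Gamma> (\<lambda>x y. y = f x)" "defset M \<Gamma> X"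
    and "\<And>y. finite {x\<in>X. f x = y} \<and> card {x\<in>X. f x = y} \<le> k" "f ` X \<in> J"
  shows "X \<in> J"
proof -
  have "\<forall>f X k. defrel M \<Gamma> (\<lambda>x y. y = f x) \<and> defset M \<Gamma> X \<and>
        (\<forall>y. finite {x\<in>X. f x = y} \<and> card {x\<in>X. f x = y} \<le> k) \<and> f ` X \<in> J \<longrightarrow> X \<in> J"
    using assms(1) unfolding rank_ideal_def by (elim conjE)
  from this[rule_format, of f X k] assms(2-5) show ?thesis by simp
qed

lemma ideal_UN:
  assumes J: "rank_ideal J" and "finite I" "\<And>i. i \<in> I \<Longrightarrow> X i \<in> J"
  shows "(\<Union>i\<in>I. X i) \<in> J"
  using assms(2,3) by (induction I) (auto intro: ideal_Un[OF J] ideal_empty[OF J])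

text \<open>
  Modulo \<open>J\<close>, a family in which no point lies in more than \<open>k\<close> members can be made disjoint.
  Either some member meets infinitely many others in sets outside \<open>J\<close>, and inside it the
  multiplicity has dropped to \<open>k - 1\<close>; or one can choose a subsequence with pairwise
  intersections in \<open>J\<close>, and remove from each member the previous ones.
\<close>

lemma bounded_multiplicity:
  fixes Z :: "nat \<Rightarrow> 'a set"
  assumes J: "rank_ideal J" and C: "base C"
    and "\<And>i. defset M C (Z i) \<and> Z i \<subseteq> X \<and> Z i \<notin> J"
    and "\<And>x. finite {i. x \<in> Z i} \<and> card {i. x \<in> Z i} \<le> k"
  shows "\<exists>Y. large_family C J X Y"
  using assms(3,4)
proof (induction k arbitrary: Z)
  case 0
  then have "Z 0 = {}" by (metis (mono_tags, lifting) card_0_eq equals0I le_zero_eq mem_Collect_eq empty_iff)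
  then show ?case using 0(1)[of 0] ideal_empty[OF J] by simp
next
  case (Suc k)
  note Z = Suc.prems(1) and mult = Suc.prems(2)
  show ?case
  proof (cases "\<exists>m. infinite {i. Z m \<inter> Z i \<notin> J}")
    case True
    then obtain m where "infinite ({i. Z m \<inter> Z i \<notin> J} - {m})" by auto
    then obtain r :: "nat \<Rightarrow> nat" where r: "strict_mono r" "\<And>n. r n \<in> {i. Z m \<inter> Z i \<notin> J} - {m}"
      using infinite_enumerate by blast
    then have inj: "inj r" by (simp add: strict_mono_imp_inj_on)
    show ?thesis
    proof (rule Suc.IH[of "\<lambda>i. Z m \<inter> Z (r i)"])
      show "defset M C (Z m \<inter> Z (r i)) \<and> Z m \<inter> Z (r i) \<subseteq> X \<and> Z m \<inter> Z (r i) \<notin> J" for i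
      proof -
        have "defset M C (Z m \<inter> Z (r i))" using Z by (intro defset_Int) simp_all
        then show ?thesis using Z[of m] r(2)[of i] by auto
      qed
      show "finite {i. x \<in> Z m \<inter> Z (r i)} \<and> card {i. x \<in> Z m \<inter> Z (r i)} \<le> k" for x
      proof (cases "x \<in> Z m")
        case True
        let ?S = "{i. x \<in> Z (r i)}"
        have sub: "r ` ?S \<subseteq> {j. x \<in> Z j} - {m}" using r(2) by auto
        have fin: "finite ({j. x \<in> Z j} - {m})" using mult[of x] by simp
        have "card ({j. x \<in> Z j} - {m}) \<le> k" using mult[of x] True by (auto simp: card_Diff_singleton)
        then have "finite (r ` ?S) \<and> card (r ` ?S) \<le> k"
          using finite_subset[OF sub fin] card_mono[OF fin sub] by linarith
        moreover have "inj_on r ?S" using inj by (rule inj_on_subset) simp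
        ultimately show ?thesis using True by (simp add: card_image finite_image_iff)
      qed simp
    qed
  next
    case False
    then have "\<forall>m. \<exists>N. \<forall>i\<in>{i. Z m \<inter> Z i \<notin> J}. i < N"
      unfolding finite_nat_set_iff_bounded by blast
    then obtain N where N: "\<And>m i. Z m \<inter> Z i \<notin> J \<Longrightarrow> i < N m" by (metis mem_Collect_eq)
    define s where "s = rec_nat 0 (\<lambda>_ q. Suc q + (\<Sum>j\<le>q. N j))"
    have s_Suc: "s (Suc n) = Suc (s n) + (\<Sum>j\<le>s n. N j)" for n by (simp add: s_def)
    have mono: "s a \<le> s b" if "a \<le> b" for a b
      by (rule lift_Suc_mono_le[of s]) (use that s_Suc in auto)
    have s: "N (s a) \<le> s n" if "a < n" for a n
    proof -
      obtain n' where n': "n = Suc n'" using \<open>a < n\<close> by (cases n) auto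
      have "N (s a) \<le> (\<Sum>j\<le>s n'. N j)"
        by (rule member_le_sum) (use mono that n' in auto)
      then show ?thesis using n' s_Suc by simp
    qed
    have inJ: "Z (s a) \<inter> Z (s n) \<in> J" if "a < n" for a n
      using N[of "s a" "s n"] s[OF that] by fastforce
    define W where "W n = Z (s n) - (\<Union>a\<in>{..<n}. Z (s a))" for n
    have dW: "defset M C (W n)" for n
      unfolding W_def by (intro defset_Diff defset_UN_finite) (use Z in auto)
    have "W n \<notin> J" for n
    proof
      assume "W n \<in> J"
      moreover have "(\<Union>a\<in>{..<n}. Z (s a) \<inter> Z (s n)) \<in> J"
        by (rule ideal_UN[OF J]) (use inJ in auto)
      ultimately have "W n \<union> (\<Union>a\<in>{..<n}. Z (s a) \<inter> Z (s n)) \<in> J" by (rule ideal_Un[OF J])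
      moreover have "W n \<union> (\<Union>a\<in>{..<n}. Z (s a) \<inter> Z (s n)) = Z (s n)" by (auto simp: W_def)
      ultimately show False using Z by simp
    qed
    moreover have "W n \<inter> W n' = {}" if "n \<noteq> n'" for n n'
      using that by (cases "n < n'") (auto simp: W_def)
    moreover have "W n \<subseteq> X" for n using Z[of "s n"] by (auto simp: W_def)
    ultimately show ?thesis using dW unfolding large_family_def by (intro exI[of _ W]) simp
  qed
qed

lemma large_family_subseq:
  fixes Y :: "nat \<Rightarrow> 'a set"
  assumes X: "defset M C X" and Y: "\<And>i. defset M C (Y i)" "\<And>i j. i \<noteq> j \<Longrightarrow> Y i \<inter> Y j = {}"
    and inf: "infinite {i. Y i \<inter> X \<notin> J}"
  shows "\<exists>Y. large_family C J X Y"
proof -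
  obtain r :: "nat \<Rightarrow> nat" where r: "strict_mono r" "\<And>n. r n \<in> {i. Y i \<inter> X \<notin> J}"
    using infinite_enumerate[OF inf] by blast
  have "defset M C (Y (r i) \<inter> X)" for i using Y(1) X by (rule defset_Int)
  moreover have "r i \<noteq> r j" if "i \<noteq> j" for i j
    using r(1) that by (simp add: strict_mono_eq)
  then have "Y (r i) \<inter> X \<inter> (Y (r j) \<inter> X) = {}" if "i \<noteq> j" for i j
    using Y(2)[of "r i" "r j"] that by blast
  ultimately show ?thesis
    using r(2) unfolding large_family_def by (intro exI[of _ "\<lambda>i. Y (r i) \<inter> X"]) simp
qed

lemma large_family_mono:
  assumes "large_family C J X Y" "C \<subseteq> C'"
  shows "large_family C' J X Y"
proof -
  have "defset M C' (Y i)" for i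
    by (rule defpred_mono[OF _ assms(2)]) (use assms(1) in \<open>simp add: large_family_def\<close>)
  then show ?thesis using assms(1) by (simp add: large_family_def)
qed

lemma rank_ideal_derived:
  assumes J: "rank_ideal J"
  shows "rank_ideal (derived J)"
  unfolding rank_ideal_def
proof (intro conjI ballI allI impI)
  show "{} \<in> derived J"
    using ideal_empty[OF J] by (auto simp: derived_def large_family_def defpred_const)
  show "defset M \<Gamma> X" if "X \<in> derived J" for X using that by (simp add: derived_def)
  show "Y \<in> derived J" if X: "X \<in> derived J" and Y: "defset M \<Gamma> Y \<and> Y \<subseteq> X" for X Y
  proof -
    have "large_family C J X Z" if "large_family C J Y Z" for C Z
      using that Y unfolding large_family_def by blast
    then show ?thesis using X Y by (auto simp: derived_def)
  qed
  show "X \<union> X' \<in> derived J" if X: "X \<in> derived J" and X': "X' \<in> derived J" for X X'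
  proof -
    have d: "defset M \<Gamma> X" "defset M \<Gamma> X'" using X X' by (auto simp: derived_def)
    have False if C: "base C" and Y: "large_family C J (X \<union> X') Y" for C Y
    proof -
      obtain C1 where C1: "base C1" "C \<subseteq> C1" "defset M C1 X"
        using C d(1) by (rule extend_base)
      obtain C2 where C2: "base C2" "C1 \<subseteq> C2" "defset M C2 X'"
        using C1(1) d(2) by (rule extend_base)
      have dX: "defset M C2 X" using C1(3) C2(2) by (rule defpred_mono)
      have "large_family C2 J (X \<union> X') Y"
        by (rule large_family_mono[OF Y]) (use C1 C2 in blast)
      then have Y2: "defset M C2 (Y i)" "Y i \<subseteq> X \<union> X'" "Y i \<notin> J"
          "i \<noteq> j \<Longrightarrow> Y i \<inter> Y j = {}" for i j
        by (auto simp: large_family_def)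
      have "Y i \<inter> X \<notin> J \<or> Y i \<inter> X' \<notin> J" for i
      proof (rule ccontr)
        assume "\<not> ?thesis"
        then have "(Y i \<inter> X) \<union> (Y i \<inter> X') \<in> J" using ideal_Un[OF J] by simp
        moreover have "(Y i \<inter> X) \<union> (Y i \<inter> X') = Y i" using Y2(2)[of i] by blast
        ultimately show False using Y2(3)[of i] by simp
      qed
      then have "{i. Y i \<inter> X \<notin> J} \<union> {i. Y i \<inter> X' \<notin> J} = UNIV" by blast
      moreover have "finite ({i. Y i \<inter> X \<notin> J} \<union> {i. Y i \<inter> X' \<notin> J})"
        if "finite {i. Y i \<inter> X \<notin> J}" "finite {i. Y i \<inter> X' \<notin> J}"
        using that by simp
      ultimately have "infinite {i. Y i \<inter> X \<notin> J} \<or> infinite {i. Y i \<inter> X' \<notin> J}"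
        using infinite_UNIV_nat by metis
      then have "(\<exists>Y. large_family C2 J X Y) \<or> (\<exists>Y. large_family C2 J X' Y)"
        using large_family_subseq[where J = J, OF dX Y2(1) Y2(4)]
          large_family_subseq[where J = J, OF C2(3) Y2(1) Y2(4)]
        by (elim disjE) simp_all
      then show False using X X' C2(1) unfolding derived_def by blast
    qed
    then show ?thesis using defset_Un[OF d] unfolding derived_def by auto
  qed
  show "X \<in> derived J"
    if as: "defrel M \<Gamma> (\<lambda>x y. y = f x) \<and> defset M \<Gamma> X \<and>
        (\<forall>y. finite {x\<in>X. f x = y} \<and> card {x\<in>X. f x = y} \<le> k) \<and> f ` X \<in> derived J" for f X k
  proof -
    have f: "defrel M \<Gamma> (\<lambda>x y. y = f x)" and X: "defset M \<Gamma> X" and fX: "f ` X \<in> derived J"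
      and fib: "\<And>y. finite {x\<in>X. f x = y}" "\<And>y. card {x\<in>X. f x = y} \<le> k"
      using as by auto
    have False if C: "base C" and Y: "large_family C J X Y" for C Y
    proof -
      obtain C' where C': "base C'" "C \<subseteq> C'" "defrel M C' (\<lambda>x y. y = f x)"
        using C f by (rule extend_base)
      from large_family_mono[OF Y C'(2)] have Y': "defset M C' (Y i)" "Y i \<subseteq> X" "Y i \<notin> J"
          "i \<noteq> j \<Longrightarrow> Y i \<inter> Y j = {}" for i j
        by (auto simp: large_family_def)
      \<comment> \<open>A point is in at most \<open>k\<close> of the images of a disjoint family, one for each preimage.\<close>
      have "\<exists>Z. large_family C' J (f ` X) Z"
      proof (rule bounded_multiplicity[OF J C'(1), of "\<lambda>i. f ` Y i" _ k])
        fix i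
        have "f ` Y i \<notin> J"
        proof
          assume "f ` Y i \<in> J"
          moreover have "finite {x\<in>Y i. f x = y} \<and> card {x\<in>Y i. f x = y} \<le> k" for y
          proof -
            have "{x\<in>Y i. f x = y} \<subseteq> {x\<in>X. f x = y}" using Y'(2) by blast
            from finite_subset[OF this fib(1)] card_mono[OF fib(1) this] fib(2)[of y]
            show ?thesis by simp
          qed
          ultimately have "Y i \<in> J"
            by (intro ideal_fibres[OF J f base_defpred[OF C'(1) Y'(1)], of i k]) simp_all
          then show False using Y'(3) by simp
        qed
        then show "defset M C' (f ` Y i) \<and> f ` Y i \<subseteq> f ` X \<and> f ` Y i \<notin> J"
          using Y' defset_image[OF C'(3) Y'(1)] by (simp add: image_mono)
      next
        fix y
        let ?I = "{i. y \<in> f ` Y i}"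
        define g where "g i = (SOME x. x \<in> Y i \<and> f x = y)" for i
        have g: "g i \<in> Y i \<and> f (g i) = y" if "i \<in> ?I" for i
          unfolding g_def by (rule someI_ex) (use that in auto)
        have "inj_on g ?I"
          by (rule inj_onI) (use g Y'(4) in \<open>metis IntI empty_iff\<close>)
        moreover have "g ` ?I \<subseteq> {x\<in>X. f x = y}" using g Y'(2) by blast
        ultimately show "finite ?I \<and> card ?I \<le> k"
          using fib[of y] by (meson card_inj_on_le inj_on_finite le_trans)
      qed
      then show False using fX C'(1) unfolding derived_def by blast
    qed
    then show ?thesis using X unfolding derived_def by auto
  qed
qed

lemma ideal_sub_derived:
  assumes J: "rank_ideal J"
  shows "J \<subseteq> derived J"
proof
  fix X assume X: "X \<in> J"
  have False if "base C" "large_family C J X Y" for C Y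
  proof -
    have "Y 0 \<in> J"
      by (rule ideal_sub[OF J X]) (use that base_defpred in \<open>auto simp: large_family_def\<close>)
    then show False using that by (simp add: large_family_def)
  qed
  then show "X \<in> derived J" using ideal_def[OF J X] by (auto simp: derived_def)
qed

text \<open>
  An algebraic parameter \<open>b\<close> of a large family can be removed: replace each member by the union
  of its conjugates.  These unions are no longer disjoint, but a point lies in at most as many of
  them as \<open>b\<close> has conjugates.
\<close>

lemma remove_parameter:
  assumes J: "rank_ideal J" and C: "base C" and b: "b \<in> \<Gamma>" and X: "defset M C X"
    and Y: "large_family (insert b C) J X Y"
  shows "\<exists>Y. large_family C J X Y"
proof -
  obtain O' where O': "finite O'" "b \<in> O'" "defset M C O'"
    and min: "\<And>X. defset M C X \<Longrightarrow> b \<in> X \<Longrightarrow> O' \<subseteq> X"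
    using conjugates[OF C b] by metis
  have "\<exists>R. defrel M C R \<and> Y i = {x. R x b}" for i
  proof -
    have "defset M (insert b C) (Y i)" using Y by (simp add: large_family_def)
    then show ?thesis by (rule defset_insert_param)
  qed
  then obtain R where R: "\<And>i. defrel M C (R i)" and YR: "\<And>i. Y i = {x. R i x b}" by metis
  have disj: "\<not> (R i x y \<and> R j x y)" if "i \<noteq> j" "y \<in> O'" for i j x y
  proof -
    have "defpred M C (\<lambda>e. \<exists>x. R i x (e 0) \<and> R j x (e 0))"
      by (rule defpred_ex[where n = 1])
         (intro dintros defpred_rel[OF R[of i]] defpred_rel[OF R[of j]], simp)
    then have "defset M C {y. \<not> (\<exists>x. R i x y \<and> R j x y)}"
      unfolding mem_Collect_eq by (rule defpred_not)
    moreover have "b \<in> {y. \<not> (\<exists>x. R i x y \<and> R j x y)}"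
      using Y YR \<open>i \<noteq> j\<close> unfolding large_family_def by blast
    ultimately show ?thesis using min that(2) by blast
  qed
  define Z where "Z i = X \<inter> {x. \<exists>y. y \<in> O' \<and> R i x y}" for i
  have dZ: "defset M C (Z i)" for i
  proof -
    have "defpred M C (\<lambda>e. \<exists>y. y \<in> O' \<and> R i (e 0) y)"
      by (rule defpred_ex[where n = 1])
         (intro dintros defpred_rel[OF R[of i]] defpred_mem[OF O'(3)], simp)
    then have "defset M C {x. \<exists>y. y \<in> O' \<and> R i x y}" by simp
    then show ?thesis unfolding Z_def using X by (intro defset_Int)
  qed
  have bC: "base (insert b C)" using C b by (auto simp: base_def)
  show ?thesis
  proof (rule bounded_multiplicity[OF J C, of Z X "card O'"])
    fix i
    have "Y i \<subseteq> Z i" using Y YR O'(2) by (auto simp: Z_def large_family_def)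
    then have "Z i \<notin> J"
      using ideal_sub[OF J, of "Z i" "Y i"] Y base_defpred[OF bC]
      by (auto simp: large_family_def)
    then show "defset M C (Z i) \<and> Z i \<subseteq> X \<and> Z i \<notin> J" using dZ by (simp add: Z_def)
  next
    fix x
    let ?I = "{i. x \<in> Z i}"
    define g where "g i = (SOME y. y \<in> O' \<and> R i x y)" for i
    have g: "g i \<in> O' \<and> R i x (g i)" if "i \<in> ?I" for i
      unfolding g_def by (rule someI_ex) (use that in \<open>auto simp: Z_def\<close>)
    have "inj_on g ?I"
      by (rule inj_onI) (use g disj in metis)
    moreover have "g ` ?I \<subseteq> O'" using g by blast
    ultimately show "finite ?I \<and> card ?I \<le> card O'"
      using O'(1) by (meson card_inj_on_le inj_on_finite)
  qed
qed

lemma reduce_to_A: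
  assumes J: "rank_ideal J" and C: "base C" and X: "defset M A X" and Y: "large_family C J X Y"
  shows "\<exists>Y. large_family A J X Y"
proof -
  have "\<exists>Y. large_family A J X Y"
    if "finite F" "F \<subseteq> \<Gamma>" "large_family (A \<union> F) J X Y" for F Y
    using that
  proof (induction F arbitrary: Y)
    case (insert b F)
    have "base (A \<union> F)" using insert finite_A A_sub by (auto simp: base_def)
    moreover have "defset M (A \<union> F) X" using X by (rule defpred_mono) simp
    moreover have "large_family (insert b (A \<union> F)) J X Y" using insert by simp
    ultimately have "\<exists>Y. large_family (A \<union> F) J X Y"
      using remove_parameter[OF J] insert.prems(1) by blast
    then show ?case using insert by blast
  qed auto
  moreover have "A \<union> C = C" "finite C" "C \<subseteq> \<Gamma>" using C by (auto simp: base_def)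
  ultimately show ?thesis using Y by metis
qed

text \<open>
  If \<open>derived J\<close> added nothing, then every definable set outside \<open>J\<close> would contain two
  disjoint ones, even with parameters in \<open>A\<close>: a perfect family.
\<close>

lemma derived_grows:
  assumes J: "rank_ideal J" and "UNIV \<notin> J"
  shows "\<exists>X. X \<in> derived J \<and> X \<notin> J"
proof (rule ccontr)
  assume no: "\<not> ?thesis"
  define P where "P = {X. defset M A X \<and> X \<notin> J}"
  have "P = {}"
  proof (rule no_perfect_family[OF small finite_A])
    show "defset M A X \<and> X \<noteq> {}" if "X \<in> P" for X
      using that ideal_empty[OF J] by (auto simp: P_def)
    show "\<exists>Y\<in>P. \<exists>Z\<in>P. Y \<subseteq> X \<and> Z \<subseteq> X \<and> Y \<inter> Z = {}" if X: "X \<in> P" for X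
    proof -
      have d: "defset M A X" using X by (simp add: P_def)
      have "X \<notin> derived J" using X no by (auto simp: P_def)
      then obtain C Y where "base C" "large_family C J X Y"
        using base_defpred[OF base_A d] by (auto simp: derived_def)
      then obtain Y where Y: "large_family A J X Y" using reduce_to_A[OF J _ d] by blast
      then have "Y 0 \<in> P" "Y 1 \<in> P" "Y 0 \<subseteq> X" "Y 1 \<subseteq> X" "Y 0 \<inter> Y 1 = {}"
        by (auto simp: large_family_def P_def)
      then show ?thesis by blast
    qed
  qed
  moreover have "UNIV \<in> P" using assms(2) by (simp add: P_def defpred_const)
  ultimately show False by blast
qed

text \<open>
  A member \<open>H\<close> of least rank of a family of nonempty definable sets: take a maximal ideal \<open>J\<close> among those that avoid the family; the strictly larger ideal \<open>derived J\<close> does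
  not avoid it.
\<close>

lemma least_rank:
  assumes "\<H> \<noteq> {}" and \<H>: "\<And>H. H \<in> \<H> \<Longrightarrow> defset M \<Gamma> H \<and> H \<noteq> {}"
  shows "\<exists>J H. rank_ideal J \<and> (\<forall>H\<in>\<H>. H \<notin> J) \<and> H \<in> \<H> \<and> H \<in> derived J"
proof -
  define \<J> where "\<J> = {J. rank_ideal J \<and> J \<inter> \<H> = {}}"
  have "\<exists>J\<in>\<J>. \<forall>X\<in>\<J>. J \<subseteq> X \<longrightarrow> X = J"
  proof (rule subset_Zorn_nonempty)
    have "rank_ideal {{}}" unfolding rank_ideal_def by (simp add: defpred_const)
    then have "{{}} \<in> \<J>" using \<H> by (auto simp: \<J>_def)
    then show "\<J> \<noteq> {}" by blast
    fix \<C> assume "\<C> \<noteq> {}" and chain: "subset.chain \<J> \<C>"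
    then have C: "\<And>J. J \<in> \<C> \<Longrightarrow> rank_ideal J" "\<And>J. J \<in> \<C> \<Longrightarrow> J \<inter> \<H> = {}"
      by (auto simp: subset.chain_def \<J>_def)
    have "rank_ideal (\<Union>\<C>)"
      unfolding rank_ideal_def
    proof (intro conjI ballI allI impI)
      show "{} \<in> \<Union>\<C>" using \<open>\<C> \<noteq> {}\<close> C(1) ideal_empty by blast
      show "defset M \<Gamma> X" if "X \<in> \<Union>\<C>" for X using that ideal_def C(1) by (metis UnionE)
      show "Y \<in> \<Union>\<C>" if "X \<in> \<Union>\<C>" "defset M \<Gamma> Y \<and> Y \<subseteq> X" for X Y
        using that ideal_sub C(1) by (metis UnionE UnionI)
      show "X \<union> Y \<in> \<Union>\<C>" if XY: "X \<in> \<Union>\<C>" "Y \<in> \<Union>\<C>" for X Y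
      proof -
        obtain J J' where "J \<in> \<C>" "X \<in> J" "J' \<in> \<C>" "Y \<in> J'" using XY by blast
        moreover from this have "J \<subseteq> J' \<or> J' \<subseteq> J" using chain by (auto simp: subset.chain_def)
        ultimately show ?thesis using ideal_Un C(1) by (metis UnionI subsetD)
      qed
      show "X \<in> \<Union>\<C>"
        if "defrel M \<Gamma> (\<lambda>x y. y = f x) \<and> defset M \<Gamma> X \<and>
          (\<forall>y. finite {x\<in>X. f x = y} \<and> card {x\<in>X. f x = y} \<le> k) \<and> f ` X \<in> \<Union>\<C>" for f X k
      proof -
        have "f ` X \<in> \<Union>\<C>" using that by (elim conjE)
        then obtain J where "J \<in> \<C>" "f ` X \<in> J" by (rule UnionE)
        moreover from this have "X \<in> J"
          by (intro ideal_fibres[OF C(1), of J f X k]) (use that in simp_all)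
        ultimately show ?thesis by blast
      qed
    qed
    moreover have "\<Union>\<C> \<inter> \<H> = {}" using C(2) by blast
    ultimately show "\<Union>\<C> \<in> \<J>" unfolding \<J>_def by simp
  qed
  then obtain J where "J \<in> \<J>" and max: "\<And>X. X \<in> \<J> \<Longrightarrow> J \<subseteq> X \<Longrightarrow> X = J"
    by auto
  then have J: "rank_ideal J" "J \<inter> \<H> = {}" by (simp_all add: \<J>_def)
  obtain H0 where H0: "H0 \<in> \<H>" using assms(1) by blast
  have "UNIV \<notin> J"
  proof
    assume "UNIV \<in> J"
    then have "H0 \<in> J" by (rule ideal_sub[OF J(1)]) (use \<H> H0 in auto)
    then show False using J(2) H0 by blast
  qed
  then have "derived J \<noteq> J" using derived_grows[OF J(1)] by blast
  then have "derived J \<notin> \<J>" using max ideal_sub_derived[OF J(1)] by blast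
  then have "derived J \<inter> \<H> \<noteq> {}" using rank_ideal_derived[OF J(1)] by (simp add: \<J>_def)
  then obtain H where H: "H \<in> \<H>" "H \<in> derived J" by auto
  have "\<forall>H\<in>\<H>. H \<notin> J" using J(2) by auto
  with J(1) H show ?thesis by (intro exI[of _ J] exI[of _ H]) simp
qed

end

section \<open>Chain conditions for definable groups\<close>

definition additive_subgroup :: "'a::ab_group_add set \<Rightarrow> bool" where
  "additive_subgroup H \<longleftrightarrow> 0 \<in> H \<and> (\<forall>x\<in>H. \<forall>y\<in>H. x - y \<in> H)"

lemma
  assumes "additive_subgroup H"
  shows subgroup_zero: "0 \<in> H"
    and subgroup_diff: "x \<in> H \<Longrightarrow> y \<in> H \<Longrightarrow> x - y \<in> H"
    and subgroup_add: "x \<in> H \<Longrightarrow> y \<in> H \<Longrightarrow> x + y \<in> H"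
proof -
  show 0: "0 \<in> H" and diff: "\<And>x y. x \<in> H \<Longrightarrow> y \<in> H \<Longrightarrow> x - y \<in> H"
    using assms by (auto simp: additive_subgroup_def)
  have minus: "- x \<in> H" if "x \<in> H" for x using diff[OF 0 that] by simp
  show "x \<in> H \<Longrightarrow> y \<in> H \<Longrightarrow> x + y \<in> H" using diff[of x "- y"] minus[of y] by simp
qed

lemma subgroup_sum:
  "additive_subgroup H \<Longrightarrow> (\<And>i. i \<in> I \<Longrightarrow> f i \<in> H) \<Longrightarrow> sum f I \<in> H"
  by (induction I rule: infinite_finite_induct) (auto intro: subgroup_zero subgroup_add)

locale ring_closure = small_closure M A
  for M :: "('f, 'r, 'a::division_ring) fo_struct" and A :: "'a set" +
  assumes ring: "expands_ring M"
begin

lemma defterm_one: "defterm M B (\<lambda>e. 1)"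
proof -
  obtain f where "f \<in> fsyms M" "farity M f = 0" "\<forall>xs. length xs = 0 \<longrightarrow> finterp M f xs = 1"
    using ring unfolding expands_ring_def has_op_def by blast
  then show ?thesis unfolding defterm_def by (intro exI[of _ "Fn f []"]) simp
qed

lemma defterm_uminus:
  assumes "defterm M B s"
  shows "defterm M B (\<lambda>e. - s e)"
proof -
  obtain f where "f \<in> fsyms M" "farity M f = 1" "\<forall>xs. length xs = 1 \<longrightarrow> finterp M f xs = - (xs ! 0)"
    using ring unfolding expands_ring_def has_op_def by blast
  moreover obtain s' where "wf_tm M B s'" "\<forall>e. eval_tm M e s' = s e"
    using assms unfolding defterm_def by blast
  ultimately show ?thesis unfolding defterm_def by (intro exI[of _ "Fn f [s']"]) simp
qed

lemma defterm_add:
  assumes "defterm M B s" "defterm M B t"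
  shows "defterm M B (\<lambda>e. s e + t e)"
proof -
  obtain f where "f \<in> fsyms M" "farity M f = 2"
    "\<forall>xs. length xs = 2 \<longrightarrow> finterp M f xs = xs ! 0 + xs ! 1"
    using ring unfolding expands_ring_def has_op_def by blast
  moreover obtain s' t' where "wf_tm M B s'" "\<forall>e. eval_tm M e s' = s e"
    "wf_tm M B t'" "\<forall>e. eval_tm M e t' = t e"
    using assms unfolding defterm_def by blast
  ultimately show ?thesis unfolding defterm_def by (intro exI[of _ "Fn f [s', t']"]) simp
qed

lemma defterm_mult:
  assumes "defterm M B s" "defterm M B t"
  shows "defterm M B (\<lambda>e. s e * t e)"
proof -
  obtain f where "f \<in> fsyms M" "farity M f = 2"
    "\<forall>xs. length xs = 2 \<longrightarrow> finterp M f xs = xs ! 0 * xs ! 1"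
    using ring unfolding expands_ring_def has_op_def by blast
  moreover obtain s' t' where "wf_tm M B s'" "\<forall>e. eval_tm M e s' = s e"
    "wf_tm M B t'" "\<forall>e. eval_tm M e t' = t e"
    using assms unfolding defterm_def by blast
  ultimately show ?thesis unfolding defterm_def by (intro exI[of _ "Fn f [s', t']"]) simp
qed

lemma defterm_diff: "defterm M B s \<Longrightarrow> defterm M B t \<Longrightarrow> defterm M B (\<lambda>e. s e - t e)"
  using defterm_add[of B s "\<lambda>e. - t e"] defterm_uminus[of B t] by simp

lemma defterm_power: "defterm M B s \<Longrightarrow> defterm M B (\<lambda>e. s e ^ n)"
  by (induction n) (simp_all add: defterm_one defterm_mult)

lemmas rintros = dintros defterm_one defterm_uminus defterm_add defterm_mult
  defterm_diff defterm_power

lemma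
  shows \<Gamma>_zero: "0 \<in> \<Gamma>" and \<Gamma>_one: "1 \<in> \<Gamma>"
    and \<Gamma>_add: "x \<in> \<Gamma> \<Longrightarrow> y \<in> \<Gamma> \<Longrightarrow> x + y \<in> \<Gamma>"
    and \<Gamma>_minus: "x \<in> \<Gamma> \<Longrightarrow> - x \<in> \<Gamma>"
    and \<Gamma>_mult: "x \<in> \<Gamma> \<Longrightarrow> y \<in> \<Gamma> \<Longrightarrow> x * y \<in> \<Gamma>"
    and \<Gamma>_inverse: "x \<in> \<Gamma> \<Longrightarrow> inverse x \<in> \<Gamma>"
  using acl_division_subring[OF ring, where A = A] by (simp_all add: \<Gamma>_def)

lemma \<Gamma>_diff: "x \<in> \<Gamma> \<Longrightarrow> y \<in> \<Gamma> \<Longrightarrow> x - y \<in> \<Gamma>"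
  using \<Gamma>_add[of x "- y"] \<Gamma>_minus[of y] by simp

lemma \<Gamma>_power: "x \<in> \<Gamma> \<Longrightarrow> x ^ n \<in> \<Gamma>"
  by (induction n) (simp_all add: \<Gamma>_one \<Gamma>_mult)

lemma translate_not_in_ideal:
  assumes J: "rank_ideal J" and H: "defset M \<Gamma> H" "H \<notin> J" and g: "g \<in> \<Gamma>"
  shows "(\<lambda>x. g + x) ` H \<notin> J"
proof
  assume "(\<lambda>x. g + x) ` H \<in> J"
  have "H \<in> J"
  proof (rule ideal_fibres[OF J _ H(1), of "\<lambda>x. g + x" 1])
    show "defpred M \<Gamma> (\<lambda>e. e 1 = g + e 0)" using g by (intro rintros)
    show "finite {x\<in>H. g + x = y} \<and> card {x\<in>H. g + x = y} \<le> 1" for y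
    proof -
      have "{x\<in>H. g + x = y} \<subseteq> {y - g}" by (auto simp: algebra_simps)
      from finite_subset[OF this] card_mono[OF _ this] show ?thesis by simp
    qed
  qed fact
  then show False using H(2) by contradiction
qed

lemma difference_not_in_ideal:
  assumes J: "rank_ideal J" and N: "defset M \<Gamma> N" "additive_subgroup N"
    and N': "defset M \<Gamma> N'" "additive_subgroup N'" "N' \<subseteq> N" "N' \<notin> J"
    and x: "x \<in> \<Gamma>" "x \<in> N" "x \<notin> N'"
  shows "N - N' \<notin> J"
proof
  assume as: "N - N' \<in> J"
  have "(\<lambda>z. x + z) ` N' \<subseteq> N - N'"
  proof (intro image_subsetI DiffI notI)
    fix z assume z: "z \<in> N'"
    then show "x + z \<in> N" using N' N x by (meson subgroup_add subsetD)
    assume "x + z \<in> N'"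
    then have "x + z - z \<in> N'" using z by (rule subgroup_diff[OF N'(2)])
    then show False using x by simp
  qed
  moreover have "defset M \<Gamma> ((\<lambda>z. x + z) ` N')"
    by (rule defset_image[OF _ N'(1)]) (use x in \<open>intro rintros\<close>)
  ultimately have "(\<lambda>z. x + z) ` N' \<in> J" by (intro ideal_sub[OF J as])
  then show False using translate_not_in_ideal[OF J N'(1) N'(4) x(1)] by contradiction
qed

text \<open>
  A descending chain of subgroups of one and the same rank, over one finite set of parameters,
  cannot go on losing points of \<open>\<Gamma>\<close>: each successive difference would contain a coset, so
  these differences would be a large family.
\<close>

lemma equal_rank_chain:
  assumes J: "rank_ideal J" and C: "base C" and H: "H \<in> derived J" "N 0 \<subseteq> H"
    and N: "\<And>i. defset M C (N i)" "\<And>i. additive_subgroup (N i)" "\<And>i. N i \<notin> J"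
    and dec: "\<And>i. N (Suc i) \<subseteq> N i"
  shows "\<exists>i. N i \<inter> \<Gamma> \<subseteq> N (Suc i)"
proof (rule ccontr)
  assume "\<not> ?thesis"
  then have "\<exists>x. x \<in> \<Gamma> \<and> x \<in> N i \<and> x \<notin> N (Suc i)" for i by blast
  then obtain x where x: "\<And>i. x i \<in> \<Gamma>" "\<And>i. x i \<in> N i" "\<And>i. x i \<notin> N (Suc i)" by metis
  have anti: "N j \<subseteq> N i" if "i \<le> j" for i j
    by (rule lift_Suc_antimono_le[of N]) (use dec that in auto)
  have "large_family C J H (\<lambda>i. N i - N (Suc i))"
    unfolding large_family_def
  proof (intro conjI allI impI)
    fix i
    show "defset M C (N i - N (Suc i))" using N(1) by (intro defset_Diff)
    show "N i - N (Suc i) \<subseteq> H" using anti[of 0 i] H(2) by blast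
    show "N i - N (Suc i) \<notin> J"
      by (rule difference_not_in_ideal[OF J base_defpred[OF C N(1)] N(2)
            base_defpred[OF C N(1)] N(2) dec N(3) x])
    fix j :: nat
    assume "i \<noteq> j"
    then have "Suc i \<le> j \<or> Suc j \<le> i" by linarith
    then show "(N i - N (Suc i)) \<inter> (N j - N (Suc j)) = {}"
      using anti[of "Suc i" j] anti[of "Suc j" i] by blast
  qed
  then show False using H(1) C by (auto simp: derived_def)
qed

text \<open>
  A subgroup of the same rank has finite index on \<open>\<Gamma>\<close>.  The cosets by elements of \<open>\<Gamma>\<close> are not
  definable over a common finite set; the union of the conjugates of a coset is, and it consists
  of finitely many cosets.  So from infinitely many cosets one obtains infinitely many disjoint
  unions of this kind.
\<close>

lemma equal_rank_finite_index:
  assumes J: "rank_ideal J" and H: "H \<in> derived J"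
    and H': "defset M \<Gamma> H'" "additive_subgroup H'" "H' \<notin> J"
    and sub: "additive_subgroup H" "H' \<subseteq> H"
    and S: "infinite S" "S \<subseteq> H \<inter> \<Gamma>"
  obtains T where "T \<subseteq> S" "infinite T" "\<And>x y. x \<in> T \<Longrightarrow> y \<in> T \<Longrightarrow> x - y \<in> H'"
proof (rule ccontr)
  note result = that
  assume no: "\<not> thesis"
  obtain C0 where C0: "base C0" "defset M C0 H'"
    using base_A H'(1) by (rule extend_base)
  have "defset M \<Gamma> H" using H by (simp add: derived_def)
  with C0(1) obtain C where C: "base C" "C0 \<subseteq> C" "defset M C H" by (rule extend_base)
  have C_H': "defset M C H'" using C0(2) C(2) by (rule defpred_mono)
  have "\<exists>O'. g \<in> \<Gamma> \<longrightarrow> finite O' \<and> g \<in> O' \<and> defset M C O' \<and> (\<forall>X. defset M C X \<and> g \<in> X \<longrightarrow> O' \<subseteq> X)" for g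
    using conjugates[OF C(1), of g] by metis
  then obtain O' where O': "\<And>g. g \<in> \<Gamma> \<Longrightarrow> finite (O' g)" "\<And>g. g \<in> \<Gamma> \<Longrightarrow> g \<in> O' g"
    "\<And>g. g \<in> \<Gamma> \<Longrightarrow> defset M C (O' g)"
    and min: "\<And>g X. g \<in> \<Gamma> \<Longrightarrow> defset M C X \<Longrightarrow> g \<in> X \<Longrightarrow> O' g \<subseteq> X"
    by metis
  define K where "K g = {x. \<exists>h. h \<in> O' g \<and> x - h \<in> H'}" for g
  have dK: "defset M C (K g)" if "g \<in> \<Gamma>" for g
  proof -
    have "defpred M C (\<lambda>e. \<exists>h. h \<in> O' g \<and> e 0 - h \<in> H')"
      by (rule defpred_ex[where n = 1])
         (intro rintros defpred_mem[OF O'(3)[OF that]] defpred_mem[OF C_H'], simp)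
    then show ?thesis by (simp add: K_def)
  qed
  have "\<exists>f :: nat \<Rightarrow> 'a. \<forall>n. f n \<in> S \<and> (\<forall>m<n. f n \<notin> K (f m))"
  proof (rule dependent_wellorder_choice[where P = "\<lambda>f n r. r \<in> S \<and> (\<forall>m<n. r \<notin> K (f m))"])
    show "(r \<in> S \<and> (\<forall>m<n. r \<notin> K (f m))) = (r \<in> S \<and> (\<forall>m<n. r \<notin> K (g m)))"
      if "\<And>m. m < n \<Longrightarrow> f m = g m" for r f g and n :: nat
      using that by auto
    show "\<exists>r. r \<in> S \<and> (\<forall>m<n. r \<notin> K (f m))"
      if f: "\<And>m. m < n \<Longrightarrow> f m \<in> S \<and> (\<forall>k<m. f m \<notin> K (f k))" for f and n :: nat
    proof (rule ccontr)
      assume "\<not> ?thesis"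
      then have "\<forall>r\<in>S. \<exists>h\<in>(\<Union>m\<in>{..<n}. O' (f m)). r - h \<in> H'" unfolding K_def by blast
      moreover have "finite (\<Union>m\<in>{..<n}. O' (f m))"
      proof (intro finite_UN_I O'(1))
        show "f m \<in> \<Gamma>" if "m \<in> {..<n}" for m using f[of m] S(2) that by auto
      qed simp
      ultimately have "\<exists>h\<in>(\<Union>m\<in>{..<n}. O' (f m)). infinite {r\<in>S. r - h \<in> H'}"
        by (intro pigeonhole_infinite_rel[OF S(1)])
      then obtain h where h: "infinite {r\<in>S. r - h \<in> H'}" by (rule bexE)
      have "x - y \<in> H'" if "x - h \<in> H'" "y - h \<in> H'" for x y
        using subgroup_diff[OF H'(2) that] by simp
      with h have thesis by (intro result[of "{r\<in>S. r - h \<in> H'}"]) auto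
      with no show False by contradiction
    qed
  qed
  then obtain g :: "nat \<Rightarrow> 'a" where "\<forall>n. g n \<in> S \<and> (\<forall>m<n. g n \<notin> K (g m))" by (rule exE)
  then have g: "g n \<in> S" "m < n \<Longrightarrow> g n \<notin> K (g m)" for m n by simp_all
  have g\<Gamma>: "g n \<in> \<Gamma>" and gH: "g n \<in> H" for n using g(1) S(2) by blast+
  have disj: "K (g n) \<inter> K (g m) = {}" if "m < n" for m n
  proof -
    have "defset M C (- K (g m))"
      using defpred_not[OF dK[OF g\<Gamma>[of m]]] by simp
    then have O'K: "O' (g n) \<subseteq> - K (g m)" using g(2)[OF \<open>m < n\<close>] by (intro min g\<Gamma>) simp_all
    have False if x: "x \<in> K (g n)" "x \<in> K (g m)" for x
    proof -
      obtain h k where h: "h \<in> O' (g n)" "x - h \<in> H'" and k: "k \<in> O' (g m)" "x - k \<in> H'"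
        using x by (auto simp: K_def)
      have "h - k \<in> H'" using subgroup_diff[OF H'(2) k(2) h(2)] by simp
      then show False using h(1) k(1) O'K by (auto simp: K_def)
    qed
    then show ?thesis by blast
  qed
  have "large_family C J H (\<lambda>n. K (g n))"
    unfolding large_family_def
  proof (intro conjI allI impI)
    fix n
    show "defset M C (K (g n))" by (rule dK[OF g\<Gamma>])
    have "O' (g n) \<subseteq> H" by (rule min[OF g\<Gamma> C(3) gH])
    moreover have "x \<in> H" if "x - h \<in> H'" "h \<in> H" for x h
      using subgroup_add[OF sub(1), of "x - h" h] sub(2) that by auto
    ultimately show "K (g n) \<subseteq> H" unfolding K_def by blast
    show "K (g n) \<notin> J"
    proof
      assume as: "K (g n) \<in> J"
      have "(\<lambda>x. g n + x) ` H' \<subseteq> K (g n)" 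
        unfolding K_def
        by (intro image_subsetI CollectI exI[of _ "g n"] conjI O'(2)[OF g\<Gamma>]) simp
      moreover have "defset M \<Gamma> ((\<lambda>x. g n + x) ` H')"
        by (rule defset_image[OF _ H'(1)]) (use g\<Gamma> in \<open>intro rintros\<close>)
      ultimately have "(\<lambda>x. g n + x) ` H' \<in> J" by (intro ideal_sub[OF J as])
      then show False using translate_not_in_ideal[OF J H'(1,3) g\<Gamma>] by contradiction
    qed
    fix m :: nat
    assume "n \<noteq> m"
    then show "K (g n) \<inter> K (g m) = {}"
      using disj[of m n] disj[of n m] by (cases "m < n") auto
  qed
  then show False using H C(1) by (auto simp: derived_def)
qed

text \<open>
  The trace on \<open>\<Gamma>\<close> of the intersection of a definable family of groups is that of a finite
  subfamily.  Among the finite intersections of the groups \<open>{x. R x l}\<close> take one of least rank,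
  definable over \<open>C\<close>, say.  Closing the set of indices under conjugation over \<open>C\<close>, every further
  intersection can be made definable over \<open>C\<close> as well, so that \<open>equal_rank_chain\<close> stops a
  descending sequence of them.
\<close>

lemma finite_subintersection:
  assumes R: "defrel M \<Gamma> R" and \<Lambda>: "defset M \<Gamma> \<Lambda>"
    and grp: "\<And>l. l \<in> \<Lambda> \<Longrightarrow> additive_subgroup {x. R x l}"
  obtains L where "finite L" "L \<subseteq> \<Lambda> \<inter> \<Gamma>"
    "\<And>x l. x \<in> \<Gamma> \<Longrightarrow> (\<And>l. l \<in> L \<Longrightarrow> R x l) \<Longrightarrow> l \<in> \<Lambda> \<inter> \<Gamma> \<Longrightarrow> R x l"
proof (rule ccontr)
  note result = that
  assume no: "\<not> thesis"
  define N where "N L = {x. \<forall>l\<in>L. R x l}" for L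
  have dN: "defset M \<Gamma> (N L)" if "finite L" "L \<subseteq> \<Gamma>" for L
    unfolding N_def mem_Collect_eq
    by (rule defpred_ball_finite[OF that(1)], rule defpred_rel[OF R])
       (use that(2) in \<open>auto intro: defterm_var defterm_par\<close>)
  have gN: "additive_subgroup (N L)" if "L \<subseteq> \<Lambda>" for L
    using grp that unfolding additive_subgroup_def N_def by auto
  define \<H> where "\<H> = N ` {L. finite L \<and> L \<subseteq> \<Lambda> \<inter> \<Gamma>}"
  have "\<exists>J H. rank_ideal J \<and> (\<forall>H\<in>\<H>. H \<notin> J) \<and> H \<in> \<H> \<and> H \<in> derived J"
  proof (rule least_rank)
    show "\<H> \<noteq> {}" by (auto simp: \<H>_def)
    show "defset M \<Gamma> H \<and> H \<noteq> {}" if "H \<in> \<H>" for H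
      using that dN gN subgroup_zero unfolding \<H>_def by blast
  qed
  then obtain J H where J: "rank_ideal J" and avoid: "\<And>H. H \<in> \<H> \<Longrightarrow> H \<notin> J"
    and H: "H \<in> \<H>" "H \<in> derived J"
    by (elim exE conjE) blast
  obtain L0 where L0: "finite L0" "L0 \<subseteq> \<Lambda> \<inter> \<Gamma>" "H = N L0" using H(1) by (auto simp: \<H>_def)
  have "defset M \<Gamma> L0" using L0 by (intro defset_finite) auto
  with base_A obtain C0 where C0: "base C0" "defset M C0 L0" by (rule extend_base)
  from C0(1) R obtain C1 where C1: "base C1" "C0 \<subseteq> C1" "defrel M C1 R" by (rule extend_base)
  from C1(1) \<Lambda> obtain C where C: "base C" "C1 \<subseteq> C" "defset M C \<Lambda>" by (rule extend_base)
  have CR: "defrel M C R" using C1(3) C(2) by (rule defpred_mono)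
  have CL0: "defset M C L0" by (rule defpred_mono[OF C0(2)]) (use C C1 in blast)
  have "\<exists>f. \<forall>n. (finite (f n) \<and> f n \<subseteq> \<Lambda> \<inter> \<Gamma> \<and> defset M C (f n) \<and> L0 \<subseteq> f n) \<and>
      (f n \<subseteq> f (Suc n) \<and> \<not> N (f n) \<inter> \<Gamma> \<subseteq> N (f (Suc n)))"
  proof (rule dependent_nat_choice)
    show "\<exists>L. finite L \<and> L \<subseteq> \<Lambda> \<inter> \<Gamma> \<and> defset M C L \<and> L0 \<subseteq> L"
      using L0 CL0 by (intro exI[of _ L0]) simp
    fix L and n :: nat
    assume L: "finite L \<and> L \<subseteq> \<Lambda> \<inter> \<Gamma> \<and> defset M C L \<and> L0 \<subseteq> L"
    have "\<exists>x l. x \<in> \<Gamma> \<and> x \<in> N L \<and> l \<in> \<Lambda> \<inter> \<Gamma> \<and> \<not> R x l"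
    proof (rule ccontr)
      assume "\<not> ?thesis"
      then have thesis using L by (intro result[of L]) (auto simp: N_def)
      with no show False by contradiction
    qed
    then obtain x l where xl: "x \<in> \<Gamma>" "x \<in> N L" "l \<in> \<Lambda>" "l \<in> \<Gamma>" "\<not> R x l" by blast
    obtain O' where O': "finite O'" "l \<in> O'" "O' \<subseteq> \<Gamma>" "defset M C O'"
      and min: "\<And>X. defset M C X \<Longrightarrow> l \<in> X \<Longrightarrow> O' \<subseteq> X"
      using conjugates[OF C(1) xl(4)] by metis
    have "O' \<subseteq> \<Lambda>" using C(3) xl(3) by (rule min)
    moreover have "defset M C (L \<union> O')" using L O'(4) by (intro defset_Un) simp_all
    moreover have "x \<in> N L \<inter> \<Gamma> \<and> x \<notin> N (L \<union> O')" using xl O'(2) by (auto simp: N_def)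
    ultimately show "\<exists>L'. (finite L' \<and> L' \<subseteq> \<Lambda> \<inter> \<Gamma> \<and> defset M C L' \<and> L0 \<subseteq> L') \<and>
        (L \<subseteq> L' \<and> \<not> N L \<inter> \<Gamma> \<subseteq> N L')"
      using L O' by (intro exI[of _ "L \<union> O'"]) auto
  qed
  then obtain f where "\<forall>n. (finite (f n) \<and> f n \<subseteq> \<Lambda> \<inter> \<Gamma> \<and> defset M C (f n) \<and> L0 \<subseteq> f n) \<and>
      (f n \<subseteq> f (Suc n) \<and> \<not> N (f n) \<inter> \<Gamma> \<subseteq> N (f (Suc n)))" by (rule exE)
  then have f: "finite (f n)" "f n \<subseteq> \<Lambda> \<inter> \<Gamma>" "defset M C (f n)" "L0 \<subseteq> f n" "f n \<subseteq> f (Suc n)"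
      and strict: "\<not> N (f n) \<inter> \<Gamma> \<subseteq> N (f (Suc n))" for n
    by auto
  have "\<exists>n. N (f n) \<inter> \<Gamma> \<subseteq> N (f (Suc n))"
  proof (rule equal_rank_chain[OF J C(1) H(2), of "\<lambda>n. N (f n)"])
    show "N (f 0) \<subseteq> H" using f(4)[of 0] L0(3) by (auto simp: N_def)
    fix n
    have "defpred M C (\<lambda>e. \<forall>l. l \<in> f n \<longrightarrow> R (e 0) l)"
      by (rule defpred_all[where n = 1])
         (intro dintros defpred_mem[OF f(3)] defpred_rel[OF CR], simp)
    then show "defset M C (N (f n))" by (simp add: N_def Ball_def)
    show "additive_subgroup (N (f n))" using f(2) by (intro gN) blast
    show "N (f n) \<notin> J" by (rule avoid) (use f in \<open>auto simp: \<H>_def\<close>)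
    show "N (f (Suc n)) \<subseteq> N (f n)" using f(5)[of n] by (auto simp: N_def)
  qed
  then show False using strict by blast
qed

end

section \<open>Linear algebra over division subrings\<close>

definition division_subring :: "'a::division_ring set \<Rightarrow> bool" where
  "division_subring E \<longleftrightarrow> 0 \<in> E \<and> 1 \<in> E \<and> (\<forall>x\<in>E. \<forall>y\<in>E. x - y \<in> E \<and> x * y \<in> E) \<and>
     (\<forall>x\<in>E. inverse x \<in> E)"

lemma
  assumes "division_subring E"
  shows subring_zero: "0 \<in> E" and subring_one: "1 \<in> E"
    and subring_diff: "x \<in> E \<Longrightarrow> y \<in> E \<Longrightarrow> x - y \<in> E"
    and subring_mult: "x \<in> E \<Longrightarrow> y \<in> E \<Longrightarrow> x * y \<in> E"
    and subring_inverse: "x \<in> E \<Longrightarrow> inverse x \<in> E"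
    and subring_minus: "x \<in> E \<Longrightarrow> - x \<in> E"
    and subring_add: "x \<in> E \<Longrightarrow> y \<in> E \<Longrightarrow> x + y \<in> E"
proof -
  show 0: "0 \<in> E" and "1 \<in> E" and diff: "\<And>x y. x \<in> E \<Longrightarrow> y \<in> E \<Longrightarrow> x - y \<in> E"
    and "x \<in> E \<Longrightarrow> y \<in> E \<Longrightarrow> x * y \<in> E" and "x \<in> E \<Longrightarrow> inverse x \<in> E"
    using assms by (auto simp: division_subring_def)
  show minus: "- x \<in> E" if "x \<in> E" for x using diff[OF 0 that] by simp
  show "x \<in> E \<Longrightarrow> y \<in> E \<Longrightarrow> x + y \<in> E" using diff[of x "- y"] minus[of y] by simp
qed

lemma subring_sum:
  "division_subring E \<Longrightarrow> (\<And>i. i \<in> I \<Longrightarrow> f i \<in> E) \<Longrightarrow> sum f I \<in> E"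
  by (induction I rule: infinite_finite_induct) (auto intro: subring_zero subring_add)

lemma homogeneous_system:
  fixes a :: "'i \<Rightarrow> 'j \<Rightarrow> 'a::division_ring"
  assumes E: "division_subring E" and "finite J" "finite I" "card J < card I"
    and "\<And>i j. i \<in> I \<Longrightarrow> j \<in> J \<Longrightarrow> a i j \<in> E"
  shows "\<exists>e. (\<forall>i\<in>I. e i \<in> E) \<and> (\<exists>i\<in>I. e i \<noteq> 0) \<and> (\<forall>j\<in>J. (\<Sum>i\<in>I. e i * a i j) = 0)"
  using assms(2-)
proof (induction J arbitrary: I a)
  case empty
  then show ?case using subring_one[OF E] by (intro exI[of _ "\<lambda>_. 1"]) (auto simp: card_gt_0_iff)
next
  case (insert j0 J)
  show ?case
  proof (cases "\<forall>i\<in>I. a i j0 = 0")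
    case True
    have "\<exists>e. (\<forall>i\<in>I. e i \<in> E) \<and> (\<exists>i\<in>I. e i \<noteq> 0) \<and> (\<forall>j\<in>J. (\<Sum>i\<in>I. e i * a i j) = 0)"
      by (rule insert.IH) (use insert in auto)
    then obtain e where "\<forall>i\<in>I. e i \<in> E" "\<exists>i\<in>I. e i \<noteq> 0" "\<forall>j\<in>J. (\<Sum>i\<in>I. e i * a i j) = 0"
      by blast
    then show ?thesis using True by (intro exI[of _ e]) simp
  next
    case False
    then obtain i0 where i0: "i0 \<in> I" "a i0 j0 \<noteq> 0" by blast
    let ?I = "I - {i0}"
    \<comment> \<open>Gaussian elimination: subtract a multiple of row \<open>i0\<close> to clear column \<open>j0\<close>.\<close>
    define m where "m i = a i j0 * inverse (a i0 j0)" for i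
    have m: "m i \<in> E" if "i \<in> I" for i
      unfolding m_def using that i0 insert.prems(3) by (intro subring_mult[OF E] subring_inverse[OF E]) auto
    have "\<exists>e. (\<forall>i\<in>?I. e i \<in> E) \<and> (\<exists>i\<in>?I. e i \<noteq> 0) \<and>
        (\<forall>j\<in>J. (\<Sum>i\<in>?I. e i * (a i j - m i * a i0 j)) = 0)"
    proof (rule insert.IH)
      show "finite ?I" "card J < card ?I" using insert i0 by auto
      show "a i j - m i * a i0 j \<in> E" if "i \<in> ?I" "j \<in> J" for i j
        using that i0 m insert.prems(3) by (intro subring_diff[OF E] subring_mult[OF E]) auto
    qed
    then obtain e where e: "\<And>i. i \<in> ?I \<Longrightarrow> e i \<in> E" "\<exists>i\<in>?I. e i \<noteq> 0"
      and sol: "\<And>j. j \<in> J \<Longrightarrow> (\<Sum>i\<in>?I. e i * (a i j - m i * a i0 j)) = 0" by blast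
    define e0 where "e0 = - (\<Sum>i\<in>?I. e i * m i)"
    define e' where "e' i = (if i = i0 then e0 else e i)" for i
    have e0: "e0 \<in> E" unfolding e0_def
      using e(1) m by (intro subring_minus[OF E] subring_sum[OF E] subring_mult[OF E]) auto
    have row: "(\<Sum>i\<in>I. e' i * a i j) = (\<Sum>i\<in>?I. e i * (a i j - m i * a i0 j))" for j
    proof -
      have "(\<Sum>i\<in>I. e' i * a i j) = e' i0 * a i0 j + (\<Sum>i\<in>?I. e' i * a i j)"
        using insert.prems(1) i0(1) by (rule sum.remove)
      also have "(\<Sum>i\<in>?I. e' i * a i j) = (\<Sum>i\<in>?I. e i * a i j)"
        by (rule sum.cong) (auto simp: e'_def)
      also have "e' i0 * a i0 j = - (\<Sum>i\<in>?I. e i * m i * a i0 j)"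
        by (simp add: e'_def e0_def sum_distrib_right)
      finally show ?thesis by (simp add: right_diff_distrib sum_subtractf mult.assoc)
    qed
    have clear: "a i j0 - m i * a i0 j0 = 0" for i
      using i0(2) by (simp add: m_def mult.assoc)
    have "(\<Sum>i\<in>I. e' i * a i j0) = 0" unfolding row clear by simp
    then have "\<forall>j\<in>insert j0 J. (\<Sum>i\<in>I. e' i * a i j) = 0" using sol row by simp
    moreover have "\<forall>i\<in>I. e' i \<in> E" using e(1) e0 by (simp add: e'_def)
    moreover obtain i1 where "i1 \<in> ?I" "e i1 \<noteq> 0" using e(2) by blast
    then have "i1 \<in> I" "e' i1 \<noteq> 0" by (simp_all add: e'_def)
    ultimately show ?thesis by (intro exI[of _ e'] conjI bexI[of _ i1])
  qed
qed

definition finite_dim :: "'a::division_ring set \<Rightarrow> 'a set \<Rightarrow> bool" where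
  "finite_dim E V \<longleftrightarrow> (\<exists>B. finite B \<and> B \<subseteq> V \<and>
     (\<forall>x\<in>V. \<exists>c. (\<forall>b\<in>B. c b \<in> E) \<and> x = (\<Sum>b\<in>B. c b * b)))"

definition dependent :: "'a::division_ring set \<Rightarrow> 'a set \<Rightarrow> bool" where
  "dependent E X \<longleftrightarrow> (\<exists>c. (\<forall>x\<in>X. c x \<in> E) \<and> (\<exists>x\<in>X. c x \<noteq> 0) \<and> (\<Sum>x\<in>X. c x * x) = 0)"

lemma finite_dim_if_dependent:
  assumes E: "division_subring E"
    and dep: "\<And>X. finite X \<Longrightarrow> X \<subseteq> V \<Longrightarrow> n < card X \<Longrightarrow> dependent E X"
  shows "finite_dim E V"
proof -
  let ?P = "\<lambda>X. finite X \<and> X \<subseteq> V \<and> \<not> dependent E X"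
  have "?P {}" by (simp add: dependent_def)
  moreover have "\<forall>X. ?P X \<longrightarrow> card X < Suc n" using dep by (metis not_less_eq)
  ultimately obtain B where B: "?P B" and max: "\<And>X. ?P X \<Longrightarrow> card X \<le> card B"
    using ex_has_greatest_nat[of ?P "{}" card "Suc n"] by blast
  have "\<exists>c. (\<forall>b\<in>B. c b \<in> E) \<and> x = (\<Sum>b\<in>B. c b * b)" if x: "x \<in> V" for x
  proof (cases "x \<in> B")
    case True
    have "(\<Sum>b\<in>B. (if b = x then 1 else 0) * b) = (\<Sum>b\<in>B. if b = x then x else 0)"
      by (rule sum.cong) auto
    also have "\<dots> = x" using True B by simp
    finally show ?thesis using subring_zero[OF E] subring_one[OF E]
      by (intro exI[of _ "\<lambda>b. if b = x then 1 else 0"]) simp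
  next
    case False
    have "dependent E (insert x B)"
    proof (rule ccontr)
      assume "\<not> dependent E (insert x B)"
      then have "card (insert x B) \<le> card B" using B x by (intro max) simp
      then show False using False B by simp
    qed
    then obtain c where c: "\<And>b. b \<in> insert x B \<Longrightarrow> c b \<in> E" "\<exists>b\<in>insert x B. c b \<noteq> 0"
      "(\<Sum>b\<in>insert x B. c b * b) = 0"
      unfolding dependent_def by blast
    then have sum: "c x * x + (\<Sum>b\<in>B. c b * b) = 0" using False B by simp
    have cx: "c x \<noteq> 0"
    proof
      assume "c x = 0"
      then have "dependent E B" using c sum unfolding dependent_def by (intro exI[of _ c]) auto
      then show False using B by simp
    qed
    have "c x * x = - (\<Sum>b\<in>B. c b * b)" using sum by (simp add: eq_neg_iff_add_eq_0)
    then have "inverse (c x) * (c x * x) = inverse (c x) * - (\<Sum>b\<in>B. c b * b)" by simp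
    then have "x = (\<Sum>b\<in>B. - inverse (c x) * c b * b)"
      using cx by (simp add: mult.assoc[symmetric] sum_distrib_left sum_negf)
    moreover have "- inverse (c x) * c b \<in> E" if "b \<in> B" for b
      using c(1) that by (intro subring_mult[OF E] subring_minus[OF E] subring_inverse[OF E]) auto
    ultimately show ?thesis by (intro exI[of _ "\<lambda>b. - inverse (c x) * c b"]) blast
  qed
  then show ?thesis using B unfolding finite_dim_def by blast
qed

lemma finite_dim_trans:
  assumes E': "division_subring E'"
    and V: "finite_dim E V" and E: "finite_dim E' E"
    and closed: "\<And>e v. e \<in> E \<Longrightarrow> v \<in> V \<Longrightarrow> e * v \<in> V"
  shows "finite_dim E' V"
proof -
  obtain B where B: "finite B" "B \<subseteq> V" "\<And>x. x \<in> V \<Longrightarrow> \<exists>c. (\<forall>b\<in>B. c b \<in> E) \<and> x = (\<Sum>b\<in>B. c b * b)"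
    using V unfolding finite_dim_def by blast
  obtain D where D: "finite D" "D \<subseteq> E" "\<And>x. x \<in> E \<Longrightarrow> \<exists>c. (\<forall>d\<in>D. c d \<in> E') \<and> x = (\<Sum>d\<in>D. c d * d)"
    using E unfolding finite_dim_def by blast
  define g where "g = (\<lambda>(b, d). d * b :: 'a)"
  have "\<exists>c. (\<forall>y\<in>g ` (B \<times> D). c y \<in> E') \<and> x = (\<Sum>y\<in>g ` (B \<times> D). c y * y)" if x: "x \<in> V" for x
  proof -
    obtain c where c: "\<And>b. b \<in> B \<Longrightarrow> c b \<in> E" "x = (\<Sum>b\<in>B. c b * b)" using B(3)[OF x] by blast
    have "\<forall>b\<in>B. \<exists>f. (\<forall>d\<in>D. f d \<in> E') \<and> c b = (\<Sum>d\<in>D. f d * d)" using D(3) c(1) by blast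
    then obtain f where f: "\<And>b d. b \<in> B \<Longrightarrow> d \<in> D \<Longrightarrow> f b d \<in> E'"
      "\<And>b. b \<in> B \<Longrightarrow> c b = (\<Sum>d\<in>D. f b d * d)" by metis
    define h where "h = (\<lambda>(b, d). f b d)"
    define c' where "c' y = (\<Sum>i\<in>{i \<in> B \<times> D. g i = y}. h i)" for y
    have "x = (\<Sum>b\<in>B. \<Sum>d\<in>D. f b d * (d * b))"
      unfolding c(2) by (rule sum.cong) (simp_all add: f(2) sum_distrib_right mult.assoc)
    also have "\<dots> = (\<Sum>i\<in>B \<times> D. h i * g i)"
      by (simp add: sum.cartesian_product h_def g_def case_prod_beta)
    also have "\<dots> = (\<Sum>y\<in>g ` (B \<times> D). \<Sum>i\<in>{i \<in> B \<times> D. g i = y}. h i * g i)"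
      using B(1) D(1) by (intro sum.image_gen) simp
    also have "\<dots> = (\<Sum>y\<in>g ` (B \<times> D). c' y * y)"
      unfolding c'_def sum_distrib_right by (intro sum.cong) auto
    finally have "x = (\<Sum>y\<in>g ` (B \<times> D). c' y * y)" .
    moreover have "c' y \<in> E'" for y
      unfolding c'_def using f(1) by (intro subring_sum[OF E']) (auto simp: h_def)
    ultimately show ?thesis by (intro exI[of _ c']) simp
  qed
  moreover have "g ` (B \<times> D) \<subseteq> V" using closed B(2) D(2) by (auto simp: g_def)
  ultimately show ?thesis using B(1) D(1) unfolding finite_dim_def by (intro exI[of _ "g ` (B \<times> D)"]) simp
qed

definition centralizer :: "'a::ring_1 set \<Rightarrow> 'a set" where
  "centralizer Y = {x. \<forall>y\<in>Y. x * y = y * x}"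

lemma division_subring_Int:
  "division_subring E \<Longrightarrow> division_subring F \<Longrightarrow> division_subring (E \<inter> F)"
  unfolding division_subring_def by blast

lemma division_subring_centralizer: "division_subring (centralizer Y)"
proof -
  have inv: "inverse z * x = x * inverse z" if "z * x = x * z" for z x :: 'a
  proof (cases "z = 0")
    case False
    have "inverse z * x = inverse z * (x * z) * inverse z" using False by (simp add: mult.assoc)
    also have "\<dots> = inverse z * (z * x) * inverse z" by (simp add: that)
    also have "\<dots> = x * inverse z" using False by (simp add: mult.assoc[symmetric])
    finally show ?thesis .
  qed simp
  have mult: "x * y * z = z * (x * y)" if "x * z = z * x" "y * z = z * y" for x y z :: 'a
    using that by (metis mult.assoc)
  have diff: "(x - y) * z = z * (x - y)" if "x * z = z * x" "y * z = z * y" for x y z :: 'a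
    unfolding left_diff_distrib right_diff_distrib that ..
  have mem: "x \<in> centralizer Y \<longleftrightarrow> (\<forall>y\<in>Y. x * y = y * x)" for x
    by (simp add: centralizer_def)
  show ?thesis unfolding division_subring_def
  proof (intro conjI ballI)
    show "0 \<in> centralizer Y" "1 \<in> centralizer Y" by (simp_all add: mem)
    fix x assume x: "x \<in> centralizer Y"
    show "inverse x \<in> centralizer Y" unfolding mem
    proof (intro ballI inv)
      show "x * z = z * x" if "z \<in> Y" for z using x that unfolding mem by blast
    qed
    fix y assume y: "y \<in> centralizer Y"
    show "x - y \<in> centralizer Y" unfolding mem
    proof (intro ballI diff)
      show "x * z = z * x" "y * z = z * y" if "z \<in> Y" for z using x y that unfolding mem by blast+
    qed
    show "x * y \<in> centralizer Y" unfolding mem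
    proof (intro ballI mult)
      show "x * z = z * x" "y * z = z * y" if "z \<in> Y" for z using x y that unfolding mem by blast+
    qed
  qed
qed

lemma division_subring_centre:
  assumes "division_subring \<Gamma>"
  shows "division_subring (centre \<Gamma>)"
proof -
  have "centre \<Gamma> = \<Gamma> \<inter> centralizer \<Gamma>" unfolding centre_def centralizer_def by blast
  then show ?thesis using division_subring_Int[OF assms division_subring_centralizer] by simp
qed

text \<open>
  The operators \<open>y \<mapsto> e x * y * x\<close>, for \<open>x\<close> in a set that is independent over the centre, are
  independent.  In a shortest relation between them one coefficient may be taken to be 1; then
  commuting the relation with \<open>y\<close> shortens it, so all coefficients are central.
\<close>

lemma central_relation:
  assumes \<Gamma>: "division_subring \<Gamma>" and X: "finite X" "X \<subseteq> \<Gamma>"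
    and "\<And>x. x \<in> X \<Longrightarrow> e x \<in> \<Gamma>" "\<exists>x\<in>X. e x \<noteq> 0" "\<And>y. y \<in> \<Gamma> \<Longrightarrow> (\<Sum>x\<in>X. e x * y * x) = 0"
  shows "dependent (centre \<Gamma>) X"
  using assms(4-)
proof (induction "card {x\<in>X. e x \<noteq> 0}" arbitrary: e rule: less_induct)
  case less
  obtain x0 where x0: "x0 \<in> X" "e x0 \<noteq> 0" using less.prems(2) by blast
  define f where "f x = inverse (e x0) * e x" for x
  have f: "f x \<in> \<Gamma>" if "x \<in> X" for x
    unfolding f_def using less.prems(1) x0(1) that by (intro subring_mult[OF \<Gamma>] subring_inverse[OF \<Gamma>])
  have f0: "f x0 = 1" using x0 by (simp add: f_def)
  have fsum: "(\<Sum>x\<in>X. f x * y * x) = 0" if "y \<in> \<Gamma>" for y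
    using less.prems(3)[OF that] by (simp add: f_def mult.assoc sum_distrib_left[symmetric])
  show ?case
  proof (cases "\<forall>x\<in>X. f x \<in> centre \<Gamma>")
    case True
    have "(\<Sum>x\<in>X. f x * x) = 0" using fsum[OF subring_one[OF \<Gamma>]] by simp
    then show ?thesis using True x0(1) f0 unfolding dependent_def
      by (intro exI[of _ f] conjI bexI[of _ x0]) simp_all
  next
    case False
    then obtain x1 y where x1: "x1 \<in> X" "y \<in> \<Gamma>" "f x1 * y \<noteq> y * f x1"
      using f by (auto simp: centre_def)
    define h where "h x = f x * y - y * f x" for x
    show ?thesis
    proof (rule less.hyps[of h])
      have "{x\<in>X. h x \<noteq> 0} \<subset> {x\<in>X. e x \<noteq> 0}"
      proof
        show "{x\<in>X. h x \<noteq> 0} \<subseteq> {x\<in>X. e x \<noteq> 0}" by (auto simp: h_def f_def)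
        have "h x0 = 0" by (simp add: h_def f0)
        then show "{x\<in>X. h x \<noteq> 0} \<noteq> {x\<in>X. e x \<noteq> 0}" using x0 by blast
      qed
      then show "card {x\<in>X. h x \<noteq> 0} < card {x\<in>X. e x \<noteq> 0}"
        by (intro psubset_card_mono) (use X(1) in auto)
      show "h x \<in> \<Gamma>" if "x \<in> X" for x
        unfolding h_def using f that x1(2) by (intro subring_diff[OF \<Gamma>] subring_mult[OF \<Gamma>])
      show "\<exists>x\<in>X. h x \<noteq> 0" using x1 by (auto simp: h_def)
      show "(\<Sum>x\<in>X. h x * z * x) = 0" if z: "z \<in> \<Gamma>" for z
      proof -
        have "(\<Sum>x\<in>X. h x * z * x) = (\<Sum>x\<in>X. f x * (y * z) * x) - y * (\<Sum>x\<in>X. f x * z * x)"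
          by (simp add: h_def left_diff_distrib sum_subtractf sum_distrib_left mult.assoc)
        then show ?thesis using fsum[OF z] fsum[OF subring_mult[OF \<Gamma> x1(2) z]] by simp
      qed
    qed
  qed
qed

text \<open>
  If \<open>\<Gamma>\<close> has dimension \<open>n\<close> over a commutative \<open>E\<close>, then right multiplications are matrices of
  size \<open>n\<close> over \<open>E\<close>, so more than \<open>n\<^sup>2\<close> of them satisfy a relation with coefficients in \<open>E\<close>.
\<close>

lemma finite_dim_over_commutative_imp_centre:
  assumes \<Gamma>: "division_subring \<Gamma>" and E: "division_subring E" "E \<subseteq> \<Gamma>"
    and comm: "\<And>x y. x \<in> E \<Longrightarrow> y \<in> E \<Longrightarrow> x * y = y * x" and dim: "finite_dim E \<Gamma>"
  shows "finite_dim_over_centre \<Gamma>"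
proof -
  obtain B where B: "finite B" "B \<subseteq> \<Gamma>"
    and span: "\<And>x. x \<in> \<Gamma> \<Longrightarrow> \<exists>c. (\<forall>b\<in>B. c b \<in> E) \<and> x = (\<Sum>b\<in>B. c b * b)"
    using dim unfolding finite_dim_def by blast
  have "dependent (centre \<Gamma>) X" if X: "finite X" "X \<subseteq> \<Gamma>" "card (B \<times> B) < card X" for X
  proof -
    have "\<forall>x\<in>X. \<forall>b\<in>B. \<exists>c. (\<forall>b'\<in>B. c b' \<in> E) \<and> b * x = (\<Sum>b'\<in>B. c b' * b')"
      using span subring_mult[OF \<Gamma>] B(2) X(2) by blast
    then obtain a where a: "\<And>x b b'. x \<in> X \<Longrightarrow> b \<in> B \<Longrightarrow> b' \<in> B \<Longrightarrow> a x b b' \<in> E"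
      "\<And>x b. x \<in> X \<Longrightarrow> b \<in> B \<Longrightarrow> b * x = (\<Sum>b'\<in>B. a x b b' * b')" by metis
    have "\<exists>e. (\<forall>x\<in>X. e x \<in> E) \<and> (\<exists>x\<in>X. e x \<noteq> 0) \<and>
        (\<forall>j\<in>B \<times> B. (\<Sum>x\<in>X. e x * a x (fst j) (snd j)) = 0)"
      by (rule homogeneous_system[OF E(1)]) (use B(1) X a(1) in auto)
    then obtain e where e: "\<And>x. x \<in> X \<Longrightarrow> e x \<in> E" "\<exists>x\<in>X. e x \<noteq> 0"
      and sys: "\<And>j. j \<in> B \<times> B \<Longrightarrow> (\<Sum>x\<in>X. e x * a x (fst j) (snd j)) = 0"
      by blast
    have eb: "(\<Sum>x\<in>X. e x * (b * x)) = 0" if b: "b \<in> B" for b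
    proof -
      have "(\<Sum>x\<in>X. e x * (b * x)) = (\<Sum>x\<in>X. \<Sum>b'\<in>B. e x * a x b b' * b')"
        by (rule sum.cong) (simp_all add: a(2) b sum_distrib_left mult.assoc)
      also have "\<dots> = (\<Sum>b'\<in>B. (\<Sum>x\<in>X. e x * a x b b') * b')"
        by (subst sum.swap) (simp add: sum_distrib_right)
      also have "\<dots> = 0" using sys[of "(b, b')" for b'] b by (intro sum.neutral) auto
      finally show ?thesis .
    qed
    show ?thesis
    proof (rule central_relation[OF \<Gamma> X(1,2) _ e(2)])
      show "e x \<in> \<Gamma>" if "x \<in> X" for x using e(1)[OF that] E(2) by blast
      fix y assume "y \<in> \<Gamma>"
      then obtain c where c: "\<And>b. b \<in> B \<Longrightarrow> c b \<in> E" "y = (\<Sum>b\<in>B. c b * b)" using span by blast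
      have "(\<Sum>x\<in>X. e x * y * x) = (\<Sum>x\<in>X. \<Sum>b\<in>B. c b * (e x * (b * x)))"
      proof (rule sum.cong)
        fix x assume x: "x \<in> X"
        have "e x * y * x = (\<Sum>b\<in>B. e x * c b * b * x)"
          by (simp add: c(2) sum_distrib_left sum_distrib_right mult.assoc)
        also have "\<dots> = (\<Sum>b\<in>B. c b * (e x * (b * x)))"
          using comm[OF e(1)[OF x] c(1)] by (intro sum.cong) (simp_all add: mult.assoc[symmetric])
        finally show "e x * y * x = (\<Sum>b\<in>B. c b * (e x * (b * x)))" .
      qed simp
      also have "\<dots> = (\<Sum>b\<in>B. c b * (\<Sum>x\<in>X. e x * (b * x)))"
        by (subst sum.swap) (simp add: sum_distrib_left)
      also have "\<dots> = 0" using eb by simp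
      finally show "(\<Sum>x\<in>X. e x * y * x) = 0" .
    qed
  qed
  then have "finite_dim (centre \<Gamma>) \<Gamma>"
    by (rule finite_dim_if_dependent[OF division_subring_centre[OF \<Gamma>]])
  then obtain D where D: "finite D" "D \<subseteq> \<Gamma>"
    and spanD: "\<And>x. x \<in> \<Gamma> \<Longrightarrow> \<exists>c. (\<forall>b\<in>D. c b \<in> centre \<Gamma>) \<and> x = (\<Sum>b\<in>D. c b * b)"
    unfolding finite_dim_def by blast
  have "(\<Sum>b\<in>D. c b * b) \<in> \<Gamma>" if "\<forall>b\<in>D. c b \<in> centre \<Gamma>" for c
    using that D(2) by (intro subring_sum[OF \<Gamma>] subring_mult[OF \<Gamma>]) (auto simp: centre_def)
  with spanD have "\<Gamma> = {x. \<exists>c. (\<forall>b\<in>D. c b \<in> centre \<Gamma>) \<and> x = (\<Sum>b\<in>D. c b * b)}" by blast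
  then show ?thesis using D unfolding finite_dim_over_centre_def by (intro exI[of _ D] conjI)
qed

lemma finite_imp_finite_dim_over_centre:
  assumes \<Gamma>: "division_subring \<Gamma>" and "finite \<Gamma>"
  shows "finite_dim_over_centre \<Gamma>"
proof -
  have "x = (\<Sum>b\<in>\<Gamma>. (if b = x then 1 else 0) * b)" if "x \<in> \<Gamma>" for x
  proof -
    have "(\<Sum>b\<in>\<Gamma>. (if b = x then 1 else 0) * b) = (\<Sum>b\<in>\<Gamma>. if b = x then x else 0)"
      by (rule sum.cong) auto
    then show ?thesis using that assms(2) by simp
  qed
  moreover have "0 \<in> centre \<Gamma>" "1 \<in> centre \<Gamma>"
    using subring_zero[OF division_subring_centre[OF \<Gamma>]] subring_one[OF division_subring_centre[OF \<Gamma>]] .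
  ultimately have "\<exists>c. (\<forall>b\<in>\<Gamma>. c b \<in> centre \<Gamma>) \<and> x = (\<Sum>b\<in>\<Gamma>. c b * b)" if "x \<in> \<Gamma>" for x
    using that by (intro exI[of _ "\<lambda>b. if b = x then 1 else 0"]) simp
  moreover have "(\<Sum>b\<in>\<Gamma>. c b * b) \<in> \<Gamma>" if "\<forall>b\<in>\<Gamma>. c b \<in> centre \<Gamma>" for c
    using that by (intro subring_sum[OF \<Gamma>] subring_mult[OF \<Gamma>]) (auto simp: centre_def)
  ultimately have "\<Gamma> = {x. \<exists>c. (\<forall>b\<in>\<Gamma>. c b \<in> centre \<Gamma>) \<and> x = (\<Sum>b\<in>\<Gamma>. c b * b)}"
    by blast
  then show ?thesis using assms(2) unfolding finite_dim_over_centre_def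
    by (intro exI[of _ \<Gamma>] conjI subset_refl)
qed

lemma finite_if_finite_dim:
  assumes "finite_dim E V" "finite E"
  shows "finite V"
proof -
  obtain B where B: "finite B"
    and span: "\<And>x. x \<in> V \<Longrightarrow> \<exists>c. (\<forall>b\<in>B. c b \<in> E) \<and> x = (\<Sum>b\<in>B. c b * b)"
    using assms(1) unfolding finite_dim_def by blast
  define \<F> where "\<F> = {c. \<forall>b. (b \<in> B \<longrightarrow> c b \<in> E) \<and> (b \<notin> B \<longrightarrow> c b = 0)}"
  have "V \<subseteq> (\<lambda>c. \<Sum>b\<in>B. c b * b) ` \<F>"
  proof
    fix x assume "x \<in> V"
    then obtain c where c: "\<forall>b\<in>B. c b \<in> E" "x = (\<Sum>b\<in>B. c b * b)" using span by blast
    define c' where "c' b = (if b \<in> B then c b else 0)" for b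
    have "c' \<in> \<F>" using c(1) by (simp add: \<F>_def c'_def)
    moreover have "x = (\<Sum>b\<in>B. c' b * b)" unfolding c(2) by (rule sum.cong) (simp_all add: c'_def)
    ultimately show "x \<in> (\<lambda>c. \<Sum>b\<in>B. c b * b) ` \<F>" by blast
  qed
  moreover have "finite \<F>" unfolding \<F>_def using B assms(2) by (rule finite_set_of_finite_funs)
  ultimately show ?thesis by (rule finite_surj[rotated])
qed

section \<open>Commuting elements in positive characteristic\<close>

lemma binomial_commuting:
  fixes x y :: "'a::ring_1"
  assumes xy: "x * y = y * x"
  shows "(x + y) ^ n = (\<Sum>k\<le>n. of_nat (n choose k) * (x ^ k * y ^ (n - k)))"
proof (induction n)
  case (Suc n)
  define f where "f k = x ^ k * y ^ (Suc n - k)" for k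
  have y: "y * x ^ k = x ^ k * y" for k using power_commuting_commutes[OF xy] by simp
  have fx: "x * (of_nat c * (x ^ k * y ^ (n - k))) = of_nat c * f (Suc k)" for k c
    by (metis (no_types, lifting) diff_Suc_Suc f_def mult.assoc mult_of_nat_commute power_Suc)
  have fy: "y * (of_nat c * (x ^ k * y ^ (n - k))) = of_nat c * f k" if "k \<le> n" for k c
  proof -
    have "y * (of_nat c * (x ^ k * y ^ (n - k))) = of_nat c * (y * x ^ k * y ^ (n - k))"
      by (metis mult.assoc mult_of_nat_commute)
    also have "\<dots> = of_nat c * f k"
      using that by (simp add: y f_def Suc_diff_le mult.assoc)
    finally show ?thesis .
  qed
  have "(x + y) ^ Suc n = x * (x + y) ^ n + y * (x + y) ^ n" by (simp add: distrib_right)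
  also have "x * (x + y) ^ n = (\<Sum>k\<le>n. of_nat (n choose k) * f (Suc k))"
    unfolding Suc.IH sum_distrib_left fx ..
  also have "y * (x + y) ^ n = (\<Sum>k\<le>n. of_nat (n choose k) * f k)"
    unfolding Suc.IH sum_distrib_left by (rule sum.cong) (simp_all only: fy atMost_iff)
  also have "(\<Sum>k\<le>n. of_nat (n choose k) * f k) = (\<Sum>k\<le>Suc n. of_nat (n choose k) * f k)"
    by (simp add: binomial_eq_0)
  also have "\<dots> = f 0 + (\<Sum>k\<le>n. of_nat (n choose Suc k) * f (Suc k))"
    by (subst sum.atMost_Suc_shift) simp
  also have "(\<Sum>k\<le>n. of_nat (n choose k) * f (Suc k)) + (f 0 + (\<Sum>k\<le>n. of_nat (n choose Suc k) * f (Suc k)))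
      = f 0 + (\<Sum>k\<le>n. of_nat (Suc n choose Suc k) * f (Suc k))"
    by (simp add: distrib_right sum.distrib add_ac)
  also have "\<dots> = (\<Sum>k\<le>Suc n. of_nat (Suc n choose k) * f k)"
    unfolding sum.atMost_Suc_shift by simp
  finally show ?case by (simp only: f_def)
qed simp

lemma prime_CHAR_division_ring:
  assumes "CHAR('a::division_ring) > 0"
  shows "prime CHAR('a)"
  unfolding prime_nat_iff
proof (intro conjI allI impI)
  show "1 < CHAR('a)" using assms CHAR_not_1[where 'a = 'a] by linarith
  fix m assume "m dvd CHAR('a)"
  then obtain k where k: "CHAR('a) = m * k" by blast
  then have "of_nat m * of_nat k = (0 :: 'a)" by (metis of_nat_CHAR of_nat_mult)
  then have "CHAR('a) dvd m \<or> CHAR('a) dvd k" by (auto simp: of_nat_eq_0_iff_char_dvd)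
  then show "m = 1 \<or> m = CHAR('a)"
    using k assms \<open>m dvd CHAR('a)\<close> by (metis dvd_antisym dvd_triv_right mult_cancel2 mult_1 not_gr_zero)
qed

lemma frobenius_commuting:
  fixes x y :: "'a::division_ring"
  assumes "CHAR('a) > 0" and xy: "x * y = y * x"
  shows "(x + y) ^ CHAR('a) = x ^ CHAR('a) + y ^ CHAR('a)"
proof -
  let ?p = "CHAR('a)"
  have p: "prime ?p" using assms(1) by (rule prime_CHAR_division_ring)
  have "(x + y) ^ ?p = (\<Sum>k\<le>?p. of_nat (?p choose k) * (x ^ k * y ^ (?p - k)))"
    using xy by (rule binomial_commuting)
  also have "\<dots> = (\<Sum>k\<in>{0, ?p}. of_nat (?p choose k) * (x ^ k * y ^ (?p - k)))"
  proof (rule sum.mono_neutral_right)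
    show "\<forall>k\<in>{..?p} - {0, ?p}. of_nat (?p choose k) * (x ^ k * y ^ (?p - k)) = 0"
    proof
      fix k assume "k \<in> {..?p} - {0, ?p}"
      then have "?p dvd (?p choose k)" using p by (intro dvd_choose_prime) auto
      then show "of_nat (?p choose k) * (x ^ k * y ^ (?p - k)) = 0"
        by (simp add: of_nat_eq_0_iff_char_dvd)
    qed
  qed auto
  also have "\<dots> = x ^ ?p + y ^ ?p" using assms(1) by simp
  finally show ?thesis .
qed

lemma frobenius_commuting_diff:
  fixes x y :: "'a::division_ring"
  assumes "CHAR('a) > 0" and xy: "x * y = y * x"
  shows "(x - y) ^ CHAR('a) = x ^ CHAR('a) - y ^ CHAR('a)"
proof -
  have "(x - y) * y = y * (x - y)" using xy by (simp add: algebra_simps)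
  from frobenius_commuting[OF assms(1) this] show ?thesis by (simp add: algebra_simps)
qed

lemma frobenius_of_nat:
  assumes "CHAR('a::division_ring) > 0"
  shows "(of_nat i :: 'a) ^ CHAR('a) = of_nat i"
proof (induction i)
  case (Suc i)
  have "(1 + of_nat i :: 'a) ^ CHAR('a) = 1 ^ CHAR('a) + of_nat i ^ CHAR('a)"
    by (rule frobenius_commuting[OF assms]) simp
  then show ?case using Suc by simp
qed (use assms in simp)

text \<open>
  Polynomials with coefficients on the left, evaluated by Horner's rule.  Linear factors of
  pairwise commuting roots can be split off on the right, even if the roots do not commute with
  the coefficients.
\<close>

primrec horner :: "'a::ring_1 list \<Rightarrow> 'a \<Rightarrow> 'a" where
  "horner [] y = 0"
| "horner (c # cs) y = c + horner cs y * y"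

fun quotient :: "'a::ring_1 list \<Rightarrow> 'a \<Rightarrow> 'a list" where
  "quotient [] a = []"
| "quotient [c] a = []"
| "quotient (c # d # cs) a = horner (d # cs) a # quotient (d # cs) a"

lemma horner_quotient:
  "y * a = a * y \<Longrightarrow> horner cs y - horner cs a = horner (quotient cs a) y * (y - a)"
proof (induction cs a rule: quotient.induct)
  case (3 c d cs a)
  let ?h = "horner (d # cs)" and ?q = "horner (quotient (d # cs) a) y"
  have IH: "?h y = ?h a + ?q * (y - a)" using 3 by (simp add: algebra_simps)
  have "horner (c # d # cs) y - horner (c # d # cs) a = ?h y * y - ?h a * a" by simp
  also have "\<dots> = ?h a * (y - a) + ?q * ((y - a) * y)"
    by (subst IH) (simp add: algebra_simps)
  also have "(y - a) * y = y * (y - a)" using 3(2) by (simp add: algebra_simps)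
  finally show ?case by (simp add: algebra_simps)
qed simp_all

lemma length_quotient: "length (quotient cs a) = length cs - 1"
  by (induction cs a rule: quotient.induct) auto

lemma last_quotient: "length cs \<ge> 2 \<Longrightarrow> last (quotient cs a) = last cs"
proof (induction cs a rule: quotient.induct)
  case (3 c d cs a)
  then show ?case by (cases cs) (auto simp: length_quotient)
qed auto

lemma card_commuting_roots:
  fixes cs :: "'a::division_ring list"
  assumes "cs \<noteq> []" "last cs \<noteq> 0" "finite Y"
    and "\<And>x y. x \<in> Y \<Longrightarrow> y \<in> Y \<Longrightarrow> x * y = y * x" "\<And>y. y \<in> Y \<Longrightarrow> horner cs y = 0"
  shows "card Y < length cs"
  using assms
proof (induction "length cs" arbitrary: cs Y)
  case (Suc n)
  show ?case
  proof (cases "Y = {}")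
    case False
    then obtain a where a: "a \<in> Y" by blast
    have "length cs \<noteq> 1"
    proof
      assume "length cs = 1"
      then obtain c where "cs = [c]" by (auto simp: length_Suc_conv)
      then show False using Suc.prems(2,5) a by auto
    qed
    then have len: "length cs \<ge> 2" using Suc.hyps(2) by linarith
    have "card (Y - {a}) < length (quotient cs a)"
    proof (rule Suc.hyps(1))
      show "n = length (quotient cs a)" using Suc.hyps(2) by (simp add: length_quotient)
      then show "quotient cs a \<noteq> []" using len Suc.hyps(2) by auto
      show "last (quotient cs a) \<noteq> 0" using last_quotient[OF len] Suc.prems(2) by simp
      show "finite (Y - {a})" using Suc.prems(3) by simp
      show "x * y = y * x" if "x \<in> Y - {a}" "y \<in> Y - {a}" for x y using Suc.prems(4) that by blast
      show "horner (quotient cs a) y = 0" if y: "y \<in> Y - {a}" for y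
      proof -
        have "horner (quotient cs a) y * (y - a) = 0"
          using horner_quotient[of y a cs] Suc.prems(4,5) y a by simp
        then show ?thesis using y by simp
      qed
    qed
    then show ?thesis using a Suc.prems(3) by (simp add: length_quotient)
  qed (use Suc in simp)
qed simp

lemma artin_schreier_fibres:
  fixes c u :: "'a::division_ring"
  assumes p: "CHAR('a) > 0" and u: "u \<noteq> 0"
    and comm: "\<And>x y. x \<in> F \<Longrightarrow> y \<in> F \<Longrightarrow> x * y = y * x"
  shows "finite {y\<in>F. u * (y ^ CHAR('a) - y) = c} \<and> card {y\<in>F. u * (y ^ CHAR('a) - y) = c} \<le> CHAR('a)"
proof (rule finite_if_finite_subsets_card_bdd)
  let ?p = "CHAR('a)"
  fix Y assume Y: "Y \<subseteq> {y\<in>F. u * (y ^ ?p - y) = c}" "finite Y"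
  define k where "k = ?p - 2"
  have k: "?p = Suc (Suc k)"
    using prime_ge_2_nat[OF prime_CHAR_division_ring[OF p]] by (simp add: k_def)
  define cs where "cs = - c # (- u) # replicate k 0 @ [u]"
  have rep: "horner (replicate k 0 @ [u]) y = u * y ^ k" for k :: nat and y
    by (induction k) (simp_all add: mult.assoc power_commutes)
  have cs: "horner cs y = u * (y ^ ?p - y) - c" for y
    unfolding cs_def k horner.simps rep by (simp add: algebra_simps power_commutes)
  have "card Y < length cs"
  proof (rule card_commuting_roots)
    show "cs \<noteq> []" "last cs \<noteq> 0" using u by (simp_all add: cs_def)
    show "x * y = y * x" if "x \<in> Y" "y \<in> Y" for x y by (rule comm) (use that Y in auto)
    show "horner cs y = 0" if "y \<in> Y" for y unfolding cs using that Y(1) by auto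
  qed fact
  then show "card Y \<le> ?p" by (simp add: cs_def k)
qed

lemma fixed_by_frobenius:
  fixes v :: "'a::division_ring"
  assumes p: "CHAR('a) > 0" and v: "v ^ CHAR('a) = v"
  shows "\<exists>i. v = of_nat i"
proof -
  let ?p = "CHAR('a)" and ?F = "insert v (of_nat ` {..<CHAR('a)})"
  have "x * y = y * x" if "x \<in> ?F" "y \<in> ?F" for x y
    using that by (metis imageE insertE mult_of_nat_commute)
  then have "card {y\<in>?F. 1 * (y ^ ?p - y) = 0} \<le> ?p"
    using artin_schreier_fibres[OF p, of 1 ?F 0] by auto
  moreover have "{y\<in>?F. 1 * (y ^ ?p - y) = 0} = ?F" using v frobenius_of_nat[OF p] by auto
  ultimately have card: "card ?F \<le> ?p" by simp
  have "inj_on (of_nat :: nat \<Rightarrow> 'a) {..<?p}"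
  proof (rule linorder_inj_onI)
    fix i j assume ij: "i < j" "i \<in> {..<?p}" "j \<in> {..<?p}"
    show "(of_nat i :: 'a) \<noteq> of_nat j"
    proof
      assume "(of_nat i :: 'a) = of_nat j"
      then have "(of_nat (j - i) :: 'a) = 0" using ij(1) by (simp add: of_nat_diff)
      then have "?p dvd j - i" by (simp add: of_nat_eq_0_iff_char_dvd)
      then show False using ij by (auto dest!: dvd_imp_le)
    qed
  qed auto
  then have "card ((of_nat :: nat \<Rightarrow> 'a) ` {..<?p}) = ?p" by (simp add: card_image)
  then have "v \<in> of_nat ` {..<?p}" using card by (metis card_insert_disjoint finite_imageI finite_lessThan Suc_n_not_le_n)
  then show ?thesis by blast
qed

text \<open>
  In the relation \<open>b * u - u * b = 1\<close> of the Weyl algebra, commuting with \<open>u\<close> differentiates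
  powers of \<open>b\<close>.
\<close>

lemma weyl_power:
  fixes b u :: "'a::ring_1"
  assumes bu: "b * u - u * b = 1"
  shows "b ^ Suc n * u - u * b ^ Suc n = of_nat (Suc n) * b ^ n"
proof (induction n)
  case (Suc n)
  have "b ^ Suc (Suc n) * u - u * b ^ Suc (Suc n)
      = b * (b ^ Suc n * u - u * b ^ Suc n) + (b * u - u * b) * b ^ Suc n"
    by (simp add: algebra_simps)
  also have "\<dots> = b * (of_nat (Suc n) * b ^ n) + b ^ Suc n" using Suc.IH bu by simp
  also have "b * (of_nat (Suc n) * b ^ n) = of_nat (Suc n) * b ^ Suc n"
    by (metis mult.assoc mult_of_nat_commute power_Suc)
  finally show ?case by (simp add: algebra_simps)
qed (use bu in simp)

text \<open>
  Hence \<open>b\<close> has no finite order: differentiating \<open>b ^ n = 1\<close> shows that the characteristic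
  divides \<open>n\<close>, and then already \<open>b ^ (n div p) = 1\<close>, by injectivity of the Frobenius map.
\<close>

lemma weyl_infinite_order:
  fixes b u :: "'a::division_ring"
  assumes p: "CHAR('a) > 0" and bu: "b * u - u * b = 1"
  shows "n > 0 \<Longrightarrow> b ^ n \<noteq> 1"
proof (induction n rule: less_induct)
  case (less n)
  show ?case
  proof
    assume n: "b ^ n = 1"
    obtain m where m: "n = Suc m" using less.prems by (cases n) auto
    have "b \<noteq> 0" using bu by auto
    have "of_nat n * b ^ m = 0" using weyl_power[OF bu, of m] n m by simp
    then have "CHAR('a) dvd n" using \<open>b \<noteq> 0\<close> by (simp add: of_nat_eq_0_iff_char_dvd)
    then obtain k where k: "n = k * CHAR('a)" by (metis dvd_div_mult_self)
    have "(b ^ k - 1) ^ CHAR('a) = (b ^ k) ^ CHAR('a) - 1 ^ CHAR('a)"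
      by (rule frobenius_commuting_diff[OF p]) simp
    also have "\<dots> = 0" using n k by (simp add: power_mult[symmetric])
    finally have "b ^ k = 1" by simp
    moreover have "k < n" "k > 0"
      using k less.prems prime_gt_1_nat[OF prime_CHAR_division_ring[OF p]] by auto
    ultimately show False using less.IH by blast
  qed
qed

section \<open>Definable division subrings\<close>

context ring_closure
begin

lemma division_subring_\<Gamma>: "division_subring \<Gamma>"
  unfolding division_subring_def
  using \<Gamma>_zero \<Gamma>_one \<Gamma>_diff \<Gamma>_mult \<Gamma>_inverse by simp

lemma defset_centralizer:
  assumes "finite S" "S \<subseteq> \<Gamma>"
  shows "defset M \<Gamma> (centralizer S)"
  unfolding centralizer_def mem_Collect_eq
proof (rule defpred_ball_finite[OF assms(1)])
  fix s assume "s \<in> S"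
  then have "s \<in> \<Gamma>" using assms(2) by blast
  then show "defpred M \<Gamma> (\<lambda>e. e 0 * s = s * e 0)" by (intro rintros)
qed

end

lemma additive_subgroup_if_division_subring:
  "division_subring E \<Longrightarrow> additive_subgroup E"
  unfolding division_subring_def additive_subgroup_def by blast

section \<open>Weakly small fields have no Artin-Schreier extensions\<close>

text \<open>
  The subgroups \<open>l * f(F)\<close>, with \<open>f(y) = y ^ p - y\<close>, have the rank of \<open>F\<close> because \<open>f\<close> has
  finite fibres; so they have finite index on \<open>\<Gamma>\<close>.  The intersection of all of them is an ideal
  of \<open>F \<inter> \<Gamma>\<close>.  It is the intersection of finitely many, hence not zero as \<open>F \<inter> \<Gamma>\<close> is infinite.
\<close>

lemma (in ring_closure) artin_schreier_onto:
  assumes p: "CHAR('a) > 0"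
    and F: "defset M \<Gamma> F" "division_subring F"
    and comm: "\<And>x y. x \<in> F \<Longrightarrow> y \<in> F \<Longrightarrow> x * y = y * x"
    and inf: "infinite (F \<inter> \<Gamma>)" and t: "t \<in> F" "t \<in> \<Gamma>"
  shows "\<exists>s\<in>F. s ^ CHAR('a) - s = t"
proof (cases "t = 0")
  case True
  then show ?thesis using subring_zero[OF F(2)] p by (intro bexI[of _ 0]) simp_all
next
  case False
  let ?p = "CHAR('a)"
  define R where "R x l \<longleftrightarrow> (\<exists>z. z \<in> F \<and> x = l * (z ^ ?p - z))" for x l
  define H where "H l = {x. R x l}" for l
  have R: "defrel M \<Gamma> R"
    unfolding R_def by (rule defpred_ex[where n = 2]) (intro rintros defpred_mem[OF F(1)], simp)
  have grp: "additive_subgroup (H l)" for l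
    unfolding additive_subgroup_def
  proof (intro conjI ballI)
    show "0 \<in> H l" unfolding H_def R_def using subring_zero[OF F(2)] p
      by (intro CollectI exI[of _ 0]) simp
    fix x y assume "x \<in> H l" "y \<in> H l"
    then obtain v w where v: "v \<in> F" "x = l * (v ^ ?p - v)" and w: "w \<in> F" "y = l * (w ^ ?p - w)"
      by (auto simp: H_def R_def)
    have "(v - w) ^ ?p = v ^ ?p - w ^ ?p" by (rule frobenius_commuting_diff[OF p comm[OF v(1) w(1)]])
    then have "x - y = l * ((v - w) ^ ?p - (v - w))" by (simp add: v w right_diff_distrib)
    then show "x - y \<in> H l" unfolding H_def R_def using subring_diff[OF F(2) v(1) w(1)] by blast
  qed
  have pow: "z ^ n \<in> F" if "z \<in> F" for z n
    by (induction n) (simp_all add: that subring_one[OF F(2)] subring_mult[OF F(2)])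
  have H_F: "H l \<subseteq> F" if "l \<in> F" for l
    unfolding H_def R_def using that pow by (auto intro!: subring_mult[OF F(2)] subring_diff[OF F(2)])
  have dH: "defset M \<Gamma> (H l)" if "l \<in> \<Gamma>" for l
    using defset_slice[OF R that] by (simp add: H_def)
  have "\<exists>J H. rank_ideal J \<and> (\<forall>H\<in>{F}. H \<notin> J) \<and> H \<in> {F} \<and> H \<in> derived J"
    by (rule least_rank) (use F(1) t in auto)
  then obtain J where J: "rank_ideal J" "F \<notin> J" "F \<in> derived J" by blast
  have HJ: "H l \<notin> J" if l: "l \<in> \<Gamma>" "l \<noteq> 0" for l
  proof
    assume "H l \<in> J"
    moreover have "H l = (\<lambda>z. l * (z ^ ?p - z)) ` F" unfolding H_def R_def by blast
    moreover have "defrel M \<Gamma> (\<lambda>x y. y = l * (x ^ ?p - x))" using l(1) by (intro rintros)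
    ultimately have "F \<in> J"
      using artin_schreier_fibres[OF p l(2) comm]
      by (intro ideal_fibres[OF J(1) _ F(1), of "\<lambda>z. l * (z ^ ?p - z)" ?p]) simp_all
    then show False using J(2) by contradiction
  qed
  have d\<Lambda>: "defset M \<Gamma> (F - {0})"
    by (intro defset_Diff F(1) defset_finite) (simp_all add: \<Gamma>_zero)
  obtain L where L: "finite L" "L \<subseteq> (F - {0}) \<inter> \<Gamma>"
    and all: "\<And>x l. x \<in> \<Gamma> \<Longrightarrow> (\<And>l. l \<in> L \<Longrightarrow> R x l) \<Longrightarrow> l \<in> (F - {0}) \<inter> \<Gamma> \<Longrightarrow> R x l"
    using finite_subintersection[OF R d\<Lambda> grp[unfolded H_def]] by blast
  have "\<exists>T. T \<subseteq> F \<inter> \<Gamma> \<and> infinite T \<and> (\<forall>x\<in>T. \<forall>y\<in>T. \<forall>l\<in>L. x - y \<in> H l)"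
    using L
  proof (induction L)
    case empty
    then show ?case using inf by (intro exI[of _ "F \<inter> \<Gamma>"]) simp
  next
    case (insert l L)
    then obtain T where T: "T \<subseteq> F \<inter> \<Gamma>" "infinite T" "\<forall>x\<in>T. \<forall>y\<in>T. \<forall>l\<in>L. x - y \<in> H l" by auto
    have l: "l \<in> F" "l \<noteq> 0" "l \<in> \<Gamma>" using insert.prems by auto
    obtain T' where T': "T' \<subseteq> T" "infinite T'" "\<And>x y. x \<in> T' \<Longrightarrow> y \<in> T' \<Longrightarrow> x - y \<in> H l"
      using equal_rank_finite_index[OF J(1,3) dH[OF l(3)] grp HJ[OF l(3,2)]
          additive_subgroup_if_division_subring[OF F(2)] H_F[OF l(1)] T(2,1)] by blast
    have "T' \<subseteq> F \<inter> \<Gamma>" using T'(1) T(1) by (rule order_trans)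
    moreover have "\<forall>x\<in>T'. \<forall>y\<in>T'. \<forall>l\<in>insert l L. x - y \<in> H l"
      using T'(1,3) T(3) by (metis insertE subsetD)
    ultimately show ?case using T'(2) by (intro exI[of _ T']) simp
  qed
  then obtain T where T: "T \<subseteq> F \<inter> \<Gamma>" "infinite T" "\<And>x y l. x \<in> T \<Longrightarrow> y \<in> T \<Longrightarrow> l \<in> L \<Longrightarrow> x - y \<in> H l"
    by blast
  obtain x where x: "x \<in> T" using infinite_imp_nonempty[OF T(2)] by blast
  obtain y where y: "y \<in> T - {x}"
    using infinite_imp_nonempty[OF infinite_remove[OF T(2), of x]] by blast
  define m where "m = x - y"
  have "x \<in> F" "x \<in> \<Gamma>" "y \<in> F" "y \<in> \<Gamma>" "y \<noteq> x" using x y T(1) by auto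
  then have m: "m \<in> F" "m \<in> \<Gamma>" "m \<noteq> 0"
    by (simp_all add: m_def subring_diff[OF F(2)] \<Gamma>_diff)
  \<comment> \<open>For \<open>l = m * inverse t\<close>, membership of \<open>m\<close> in \<open>l * f(F)\<close> means that \<open>t\<close> is in \<open>f(F)\<close>.\<close>
  define l where "l = m * inverse t"
  have l: "l \<in> F" "l \<in> \<Gamma>" "l \<noteq> 0"
    using m t False by (auto simp: l_def intro: subring_mult[OF F(2)] subring_inverse[OF F(2)] \<Gamma>_mult \<Gamma>_inverse)
  have mL: "R m l'" if "l' \<in> L" for l'
    using T(3)[OF x _ that, of y] y by (simp add: m_def H_def)
  have "R m l" by (rule all[OF m(2)], rule mL) (use l in simp_all)
  then obtain z where z: "z \<in> F" "m = l * (z ^ ?p - z)" by (auto simp: R_def)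
  have "l * t = l * (z ^ ?p - z)" using z(2) False by (simp add: l_def mult.assoc)
  then show ?thesis using z(1) l(3) by (intro bexI[of _ z]) simp_all
qed

section \<open>There is no Weyl algebra in a weakly small division ring\<close>

text \<open>
  From \<open>b * u - u * b = 1\<close> one gets \<open>b * w * inverse b = w + 1\<close> for \<open>w = u * b\<close>, and \<open>t = w ^ p - w\<close>
  commutes with \<open>b\<close> and \<open>w\<close>.  An Artin-Schreier root \<open>s\<close> of \<open>t\<close> in the bicommutant of \<open>t\<close>
  commutes with both as well, so \<open>w - s\<close> is in the prime field, and \<open>w\<close> commutes with \<open>b\<close>.
  The element \<open>b ^ p\<close>, which commutes with \<open>b\<close> and \<open>w\<close> and has infinite order, is added to \<open>t\<close>
  to make the bicommutant infinite.
\<close>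

lemma no_weyl_pair:
  fixes M :: "('f, 'r, 'a::division_ring) fo_struct" and b u :: 'a
  assumes M: "expands_ring M" "weakly_small M" and p: "CHAR('a) > 0"
  shows "b * u - u * b \<noteq> 1"
proof
  assume bu: "b * u - u * b = 1"
  interpret ring_closure M "{b, u}" by unfold_locales (use M in simp_all)
  let ?p = "CHAR('a)"
  have b\<Gamma>: "b \<in> \<Gamma>" and u\<Gamma>: "u \<in> \<Gamma>" using A_sub by auto
  have b0: "b \<noteq> 0" using bu by auto
  define c where "c = b ^ ?p"
  define w where "w = u * b"
  define t where "t = w ^ ?p - w"
  have bu': "b * u = u * b + 1" using bu by (simp add: algebra_simps)
  have bw: "b * w = (w + 1) * b" unfolding w_def mult.assoc[symmetric] bu' ..
  have "b * w ^ n = (w + 1) ^ n * b" for n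
  proof (induction n)
    case (Suc n)
    have "b * w ^ Suc n = (w + 1) * (b * w ^ n)" by (simp add: bw mult.assoc[symmetric])
    then show ?case by (simp add: Suc mult.assoc)
  qed simp
  moreover have "(w + 1) ^ ?p = w ^ ?p + 1 ^ ?p" by (rule frobenius_commuting[OF p]) simp
  ultimately have bt: "b * t = t * b"
    by (simp add: t_def right_diff_distrib left_diff_distrib bw distrib_right)
  have cb: "c * b = b * c" unfolding c_def by (rule power_commutes)
  obtain q where q: "?p = Suc q" using p by (cases ?p) auto
  have "c * u - u * c = of_nat ?p * b ^ q" unfolding c_def q by (rule weyl_power[OF bu])
  then have cu: "c * u = u * c" by simp
  have cw: "c * w = w * c"
  proof -
    have "c * w = c * u * b" by (simp add: w_def mult.assoc)
    also have "\<dots> = u * (c * b)" unfolding cu by (rule mult.assoc)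
    also have "\<dots> = w * c" unfolding cb by (simp add: w_def mult.assoc)
    finally show ?thesis .
  qed
  have wt: "w * t = t * w" by (simp add: t_def right_diff_distrib left_diff_distrib power_commutes)
  have ct: "c * t = t * c"
    unfolding c_def using power_commuting_commutes[OF bt] by simp
  define K where "K = centralizer {t, c}"
  define F where "F = K \<inter> centralizer K"
  have wK: "w \<in> K" and bK: "b \<in> K" and tK: "t \<in> K" and cK: "c \<in> K"
    using wt cw bt cb ct by (simp_all add: K_def centralizer_def)
  have tF: "t \<in> F" and cF: "c \<in> F"
    using tK cK by (auto simp: F_def K_def centralizer_def)
  have comm: "x * y = y * x" if "x \<in> F" "y \<in> K" for x y
    using that by (simp add: F_def centralizer_def)
  have F: "division_subring F"
    unfolding F_def K_def by (intro division_subring_Int division_subring_centralizer)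
  have w\<Gamma>: "w \<in> \<Gamma>" and c\<Gamma>: "c \<in> \<Gamma>" using b\<Gamma> u\<Gamma> by (simp_all add: w_def c_def \<Gamma>_mult \<Gamma>_power)
  have t\<Gamma>: "t \<in> \<Gamma>" using w\<Gamma> by (simp add: t_def \<Gamma>_diff \<Gamma>_power)
  have dK: "defset M \<Gamma> K" unfolding K_def using t\<Gamma> c\<Gamma> by (intro defset_centralizer) simp_all
  have dF: "defset M \<Gamma> F"
  proof -
    have "defpred M \<Gamma> (\<lambda>e. e 0 \<in> K \<and> (\<forall>y. y \<in> K \<longrightarrow> e 0 * y = y * e 0))"
      by (rule defpred_conj[OF dK], rule defpred_all[where n = 1])
         (intro rintros defpred_mem[OF dK], simp)
    then show ?thesis by (simp add: F_def centralizer_def Ball_def)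
  qed
  have inj: "inj (\<lambda>n. c ^ n)"
  proof (rule linorder_injI)
    fix i j :: nat assume "i < j"
    show "c ^ i \<noteq> c ^ j"
    proof
      assume "c ^ i = c ^ j"
      also have "\<dots> = c ^ i * c ^ (j - i)" using \<open>i < j\<close> by (simp add: power_add[symmetric])
      finally have "c ^ (j - i) = 1" using b0 by (simp add: c_def)
      then have "b ^ (?p * (j - i)) = 1" by (simp add: c_def power_mult)
      then show False using weyl_infinite_order[OF p bu, of "?p * (j - i)"] p \<open>i < j\<close> by simp
    qed
  qed
  have "c ^ n \<in> F" for n
    by (induction n) (simp_all add: cF subring_one[OF F] subring_mult[OF F])
  then have "range (\<lambda>n. c ^ n) \<subseteq> F \<inter> \<Gamma>" using c\<Gamma> \<Gamma>_power by blast
  then have "infinite (F \<inter> \<Gamma>)" using range_inj_infinite[OF inj] by (rule infinite_super)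
  then obtain s where s: "s \<in> F" "s ^ ?p - s = t"
    using artin_schreier_onto[OF p dF F _ _ tF t\<Gamma>] comm by (auto simp: F_def)
  have sw: "s * w = w * s" and sb: "s * b = b * s" using comm[OF s(1)] wK bK by simp_all
  define v where "v = w - s"
  have "v ^ ?p = w ^ ?p - s ^ ?p" unfolding v_def by (rule frobenius_commuting_diff[OF p]) (simp add: sw)
  moreover have "w ^ ?p = w + t" "s ^ ?p = s + t" using s(2) by (simp_all add: t_def algebra_simps)
  ultimately have "v ^ ?p = v" by (simp add: v_def)
  then obtain i where "v = of_nat i" using fixed_by_frobenius[OF p] by blast
  then have "b * v = v * b" by (simp add: mult_of_nat_commute)
  then have "b * w - b * s = w * b - s * b" by (simp add: v_def right_diff_distrib left_diff_distrib)
  then have "b * w = w * b" by (simp add: sb)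
  then show False using bw b0 by (simp add: distrib_right)
qed

section \<open>Centralizers have finite codimension\<close>

context ring_closure
begin

text \<open>
  Let \<open>D\<close> be the centralizer of \<open>S\<close>, \<open>K\<close> that of \<open>S\<close> and \<open>b\<close>, and \<open>I\<close> the image of \<open>D\<close> under
  \<open>ad x = b * x - x * b\<close>.  The absence of Weyl pairs says that \<open>I\<close> meets \<open>K\<close> only in 0; so \<open>ad\<close> is
  injective on \<open>I\<close>, and by the chain condition for its iterated images it is onto on \<open>I \<inter> \<Gamma>\<close>.
  Therefore \<open>D \<inter> \<Gamma> = (K \<inter> \<Gamma>) + (I \<inter> \<Gamma>)\<close>.  So each group \<open>{x. x * l \<in> I}\<close> has codimension at
  most 1 over \<open>K\<close>; their intersection over all \<open>l\<close> is 0, and it is the intersection of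
  finitely many.
\<close>

lemma finite_dim_over_centralizer:
  assumes p: "CHAR('a) > 0" and S: "finite S" "S \<subseteq> \<Gamma>" and b: "b \<in> centralizer S" "b \<in> \<Gamma>"
  shows "finite_dim (centralizer (insert b S) \<inter> \<Gamma>) (centralizer S \<inter> \<Gamma>)"
proof -
  define D where "D = centralizer S"
  define K where "K = centralizer (insert b S) \<inter> \<Gamma>"
  define ad where "ad x = b * x - x * b" for x
  define I where "I = ad ` D"
  have D: "division_subring D" unfolding D_def by (rule division_subring_centralizer)
  have K: "division_subring K"
    unfolding K_def by (intro division_subring_Int division_subring_centralizer division_subring_\<Gamma>)
  have K_iff: "x \<in> K \<longleftrightarrow> x \<in> D \<and> x \<in> \<Gamma> \<and> x * b = b * x" for x
    by (auto simp: K_def D_def centralizer_def)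
  have weyl: "c * u - u * c \<noteq> 1" for c u :: 'a
    by (rule no_weyl_pair[OF ring small p])
  have double: "c * z - z * c = 0"
    if "(c * z - z * c) * c = c * (c * z - z * c)" for c z :: 'a
  proof (rule ccontr)
    define y where "y = c * z - z * c"
    assume "c * z - z * c \<noteq> 0"
    then have y: "y \<noteq> 0" "y * c = c * y" using that by (simp_all add: y_def)
    have "inverse y * c = inverse y * (c * y) * inverse y" using y(1) by (simp add: mult.assoc)
    also have "\<dots> = c * inverse y" using y(1) by (simp add: y(2)[symmetric] mult.assoc[symmetric])
    finally have "c * (z * inverse y) - z * inverse y * c = y * inverse y"
      by (simp add: y_def left_diff_distrib mult.assoc)
    then show False using weyl[of c "z * inverse y"] y(1) by simp
  qed
  have double_inj: "x = y"
    if "x = c * v - v * c" "y = c * w - w * c" "c * x - x * c = c * y - y * c" for c v w x y :: 'a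
  proof -
    have xy: "x - y = c * (v - w) - (v - w) * c" unfolding that(1,2) by (simp add: algebra_simps)
    have "(x - y) * c = c * (x - y)" using that(3) by (simp add: algebra_simps)
    then have "x - y = 0" unfolding xy by (rule double)
    then show ?thesis by simp
  qed
  have ad_diff: "ad (x - y) = ad x - ad y" for x y by (simp add: ad_def algebra_simps)
  have ad_D: "ad x \<in> D" if "x \<in> D" for x
    unfolding ad_def using that b(1) by (intro subring_diff[OF D] subring_mult[OF D]) (simp_all add: D_def)
  have ad_\<Gamma>: "ad x \<in> \<Gamma>" if "x \<in> \<Gamma>" for x
    unfolding ad_def using that b(2) by (intro \<Gamma>_diff \<Gamma>_mult)
  have I_D: "I \<subseteq> D" using ad_D by (auto simp: I_def)
  have ad_I: "ad ` I \<subseteq> I" unfolding I_def using ad_D by auto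
  have inj: "inj_on ad I"
  proof (rule inj_onI)
    fix x y assume "x \<in> I" "y \<in> I" "ad x = ad y"
    then show "x = y" using double_inj[of x b _ y] by (auto simp: I_def ad_def)
  qed
  have grp_image: "additive_subgroup (ad ` H)" if "additive_subgroup H" for H
    using that unfolding additive_subgroup_def
  proof (intro conjI ballI)
    assume H: "0 \<in> H \<and> (\<forall>x\<in>H. \<forall>y\<in>H. x - y \<in> H)"
    have "ad 0 = 0" by (simp add: ad_def)
    then show "0 \<in> ad ` H" using H by force
    fix x y assume "x \<in> ad ` H" "y \<in> ad ` H"
    then show "x - y \<in> ad ` H" using H by (auto simp: ad_diff[symmetric])
  qed
  have grp_I: "additive_subgroup I"
    unfolding I_def by (intro grp_image additive_subgroup_if_division_subring D)
  have dD: "defset M \<Gamma> D" unfolding D_def using S by (rule defset_centralizer)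
  have d_ad: "defrel M \<Gamma> (\<lambda>x y. y = ad x)" unfolding ad_def using b(2) by (intro rintros)
  have dI: "defset M \<Gamma> I" unfolding I_def using d_ad dD by (rule defset_image)
  have onto: "\<exists>x\<in>I. y = ad x" if y: "y \<in> I" "y \<in> \<Gamma>" for y
  proof -
    define N where "N i = (ad ^^ i) ` I" for i
    have N_Suc: "N (Suc i) = ad ` N i" for i by (simp add: N_def image_comp)
    have N_Suc': "N (Suc i) = (ad ^^ i) ` ad ` I" for i by (simp add: N_def image_comp funpow_Suc_right del: funpow.simps)
    have N_0: "N 0 = I" by (simp add: N_def)
    have dec: "N (Suc i) \<subseteq> N i" for i unfolding N_Suc' unfolding N_def by (intro image_mono ad_I)
    have N_I: "N i \<subseteq> I" for i
      by (induction i) (use N_0 dec in blast)+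
    from base_A d_ad obtain C0 where C0: "base C0" "defrel M C0 (\<lambda>x y. y = ad x)"
      by (rule extend_base)
    from C0(1) dI obtain C where C: "base C" "C0 \<subseteq> C" "defset M C I" by (rule extend_base)
    have C_ad: "defrel M C (\<lambda>x y. y = ad x)" using C0(2) C(2) by (rule defpred_mono)
    have dN: "defset M C (N i)" for i
      by (induction i) (simp_all only: N_0 N_Suc C(3) defset_image[OF C_ad])
    have gN: "additive_subgroup (N i)" for i
      by (induction i) (simp_all only: N_0 N_Suc grp_I grp_image)
    have "\<exists>J H. rank_ideal J \<and> (\<forall>H\<in>{I}. H \<notin> J) \<and> H \<in> {I} \<and> H \<in> derived J"
      by (rule least_rank) (use dI y in auto)
    then obtain J where J: "rank_ideal J" "I \<notin> J" "I \<in> derived J" by blast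
    have NJ: "N i \<notin> J" for i
    proof (induction i)
      case (Suc i)
      show ?case
      proof
        assume as: "N (Suc i) \<in> J"
        have "finite {x\<in>N i. ad x = z} \<and> card {x\<in>N i. ad x = z} \<le> 1" for z
        proof -
          have "x = x'" if "x \<in> {x\<in>N i. ad x = z}" "x' \<in> {x\<in>N i. ad x = z}" for x x'
            using inj N_I[of i] that unfolding inj_on_def by blast
          then have "\<exists>x. {x\<in>N i. ad x = z} \<subseteq> {x}" by blast
          then obtain x where sub: "{x\<in>N i. ad x = z} \<subseteq> {x}" ..
          from finite_subset[OF this] card_mono[OF _ this] show ?thesis by simp
        qed
        then have "N i \<in> J"
          by (intro ideal_fibres[OF J(1) d_ad base_defpred[OF C(1) dN], where k = 1])
             (use as N_Suc in simp_all)
        then show False using Suc by contradiction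
      qed
    qed (simp add: N_0 J(2))
    have "\<exists>i. N i \<inter> \<Gamma> \<subseteq> N (Suc i)"
      by (rule equal_rank_chain[where N = N, OF J(1) C(1) J(3) _ dN gN NJ dec]) (simp add: N_0)
    then obtain i where i: "N i \<inter> \<Gamma> \<subseteq> N (Suc i)" ..
    have "(ad ^^ k) y \<in> \<Gamma>" for k by (induction k) (simp_all add: y(2) ad_\<Gamma>)
    then have "(ad ^^ i) y \<in> N (Suc i)" using y(1) i by (auto simp: N_def)
    then obtain x where x: "x \<in> I" "(ad ^^ i) y = (ad ^^ i) (ad x)" unfolding N_Suc' by blast
    have "(ad ^^ k) ` I \<subseteq> I" for k using N_I[of k] by (simp add: N_def)
    then have "inj_on (ad ^^ k) I" for k
    proof (induction k)
      case (Suc k)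
      have "inj_on ad ((ad ^^ k) ` I)" by (rule inj_on_subset[OF inj]) (rule Suc.prems)
      then show ?case using comp_inj_on[OF Suc.IH[OF Suc.prems], of ad] by (simp add: comp_def)
    qed simp
    then have "y = ad x" using x y(1) ad_I unfolding inj_on_def by blast
    then show ?thesis using x(1) by blast
  qed
  have algebraic: "x \<in> \<Gamma>" if "x \<in> I" "ad x \<in> \<Gamma>" for x
  proof -
    \<comment> \<open>By injectivity, \<open>x\<close> is the only commutator of \<open>b\<close> with the given value of \<open>ad\<close>.\<close>
    define P where "P x c y \<longleftrightarrow> (\<exists>z. x = c * z - z * c) \<and> c * x - x * c = y" for x c y :: 'a
    have "defpred M A (\<lambda>e. (\<exists>z. e 0 = e 1 * z - z * e 1) \<and> e 1 * e 0 - e 0 * e 1 = e 2)"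
      by (rule defpred_conj, rule defpred_ex[where n = 3]) (intro rintros, simp, intro rintros)
    then have "defpred M A (\<lambda>e. P (e 0) (e 1) (e 2))" unfolding P_def .
    then obtain \<rho> where \<rho>: "wf_fm M A \<rho>" "fv_fm \<rho> \<subseteq> {0, 1, 2}" "\<forall>e. sat M e \<rho> \<longleftrightarrow> P (e 0) (e 1) (e 2)"
      using defpred_fv[of M A "\<lambda>e. P (e 0) (e 1) (e 2)" "{0, 1, 2}"] by force
    have "finite {x. P x c y}" for c y
    proof -
      have "x = x'" if PP: "P x c y" "P x' c y" for x x'
      proof -
        obtain v w where "x = c * v - v * c" "x' = c * w - w * c" using PP by (auto simp: P_def)
        then show ?thesis by (rule double_inj) (use PP in \<open>simp add: P_def\<close>)
      qed
      then have "\<exists>x. {x. P x c y} \<subseteq> {x}" by blast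
      then obtain x where "{x. P x c y} \<subseteq> {x}" ..
      then show ?thesis by (rule finite_subset) simp
    qed
    moreover have "P x b (ad x)" using that(1) by (auto simp: P_def I_def ad_def)
    ultimately show ?thesis
      unfolding \<Gamma>_def using \<rho>(3)
      by (intro acl_closed_under_definable[OF b(2)[unfolded \<Gamma>_def] that(2)[unfolded \<Gamma>_def] \<rho>(1,2),
            where D = P]) simp_all
  qed
  have decompose: "\<exists>k\<in>K. g - k \<in> I" if g: "g \<in> D" "g \<in> \<Gamma>" for g
  proof -
    have "ad g \<in> I" "ad g \<in> \<Gamma>" using g ad_\<Gamma> by (simp_all add: I_def)
    then obtain x where x: "x \<in> I" "ad g = ad x" using onto by blast
    then have "x \<in> \<Gamma>" using algebraic[of x] \<open>ad g \<in> \<Gamma>\<close> by simp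
    moreover have "ad (g - x) = 0" using x(2) by (simp add: ad_diff)
    moreover have "x \<in> D" using x(1) I_D by blast
    ultimately have "g - x \<in> K"
      using g by (simp add: K_iff subring_diff[OF D] \<Gamma>_diff ad_def)
    then show ?thesis using x(1) by (intro bexI[of _ "g - x"]) simp_all
  qed
  define R where "R x l \<longleftrightarrow> x * l \<in> I" for x l
  have dR: "defrel M \<Gamma> R" unfolding R_def by (intro defpred_mem[OF dI] rintros)
  have grp_R: "additive_subgroup {x. R x l}" for l
    using grp_I unfolding additive_subgroup_def R_def by (simp add: left_diff_distrib)
  obtain L where L: "finite L" "L \<subseteq> D \<inter> \<Gamma>"
    and all: "\<And>x l. x \<in> \<Gamma> \<Longrightarrow> (\<And>l. l \<in> L \<Longrightarrow> R x l) \<Longrightarrow> l \<in> D \<inter> \<Gamma> \<Longrightarrow> R x l"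
    using finite_subintersection[OF dR dD grp_R] by blast
  have zero: "x = 0" if x: "x \<in> D" "x \<in> \<Gamma>" "\<And>l. l \<in> L \<Longrightarrow> x * l \<in> I" for x
  proof (rule ccontr)
    assume "x \<noteq> 0"
    have "R x (inverse x)"
      by (rule all) (use x in \<open>simp_all add: R_def subring_inverse[OF D] \<Gamma>_inverse\<close>)
    then have "1 \<in> I" using \<open>x \<noteq> 0\<close> by (simp add: R_def)
    then show False using weyl[of b] by (auto simp: I_def ad_def)
  qed
  have "finite_dim K (D \<inter> \<Gamma>)"
  proof (rule finite_dim_if_dependent[OF K])
    fix X assume X: "finite X" "X \<subseteq> D \<inter> \<Gamma>" "card L < card X"
    have "\<exists>k\<in>K. x * l - k \<in> I" if "x \<in> X" "l \<in> L" for x l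
      using that X(2) L(2) by (intro decompose subring_mult[OF D] \<Gamma>_mult) auto
    then obtain k where k: "\<And>x l. x \<in> X \<Longrightarrow> l \<in> L \<Longrightarrow> k x l \<in> K \<and> x * l - k x l \<in> I" by metis
    have "\<exists>e. (\<forall>x\<in>X. e x \<in> K) \<and> (\<exists>x\<in>X. e x \<noteq> 0) \<and> (\<forall>l\<in>L. (\<Sum>x\<in>X. e x * k x l) = 0)"
      by (rule homogeneous_system[OF K L(1) X(1,3)]) (use k in simp)
    then obtain e where e: "\<And>x. x \<in> X \<Longrightarrow> e x \<in> K" "\<exists>x\<in>X. e x \<noteq> 0"
      and sol: "\<And>l. l \<in> L \<Longrightarrow> (\<Sum>x\<in>X. e x * k x l) = 0" by blast
    define s where "s = (\<Sum>x\<in>X. e x * x)"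
    have K_I: "f * x \<in> I" if f: "f \<in> K" and x: "x \<in> I" for f x
    proof -
      obtain z where z: "z \<in> D" "x = ad z" using x by (auto simp: I_def)
      have "f * b = b * f" "f \<in> D" using f by (simp_all add: K_iff)
      then have "f * x = ad (f * z)" by (simp add: z(2) ad_def right_diff_distrib mult.assoc[symmetric])
      then show ?thesis using subring_mult[OF D \<open>f \<in> D\<close> z(1)] by (simp add: I_def)
    qed
    have "s = 0"
    proof (rule zero)
      show "s \<in> D" unfolding s_def using e(1) X(2)
        by (intro subring_sum[OF D] subring_mult[OF D]) (auto simp: K_iff)
      show "s \<in> \<Gamma>" unfolding s_def using e(1) X(2)
        by (intro subring_sum[OF division_subring_\<Gamma>] \<Gamma>_mult) (auto simp: K_iff)
      fix l assume l: "l \<in> L"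
      have "s * l = (\<Sum>x\<in>X. e x * (x * l - k x l)) + (\<Sum>x\<in>X. e x * k x l)"
        by (simp add: s_def sum_distrib_right right_diff_distrib sum_subtractf mult.assoc)
      also have "\<dots> = (\<Sum>x\<in>X. e x * (x * l - k x l))" using sol[OF l] by simp
      also have "\<dots> \<in> I" using e(1) k l by (intro subgroup_sum[OF grp_I] K_I) auto
      finally show "s * l \<in> I" .
    qed
    then show "dependent K X" unfolding dependent_def s_def using e by (intro exI[of _ e]) simp
  qed
  then show ?thesis by (simp add: K_def D_def)
qed

text \<open>
  Among the centralizers of finite subsets of \<open>\<Gamma>\<close> over which \<open>\<Gamma>\<close> has finite dimension take one of
  least rank.  If two of its elements \<open>a\<close>, \<open>c\<close> did not commute, then passing to the
  centralizer of \<open>a\<close> would lower the rank: the multiples of \<open>c\<close> by elements of the smaller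
  centralizer lie in different cosets of it.
\<close>

lemma finite_dim_over_centre_\<Gamma>:
  assumes p: "CHAR('a) > 0"
  shows "finite_dim_over_centre \<Gamma>"
proof (cases "finite \<Gamma>")
  case True
  then show ?thesis by (rule finite_imp_finite_dim_over_centre[OF division_subring_\<Gamma>])
next
  case False
  define \<H> where "\<H> = centralizer ` {S. finite S \<and> S \<subseteq> \<Gamma> \<and> finite_dim (centralizer S \<inter> \<Gamma>) \<Gamma>}"
  have \<H>I: "centralizer S \<in> \<H>" if "finite S" "S \<subseteq> \<Gamma>" "finite_dim (centralizer S \<inter> \<Gamma>) \<Gamma>" for S
    using that by (auto simp: \<H>_def)
  have "\<exists>J H. rank_ideal J \<and> (\<forall>H\<in>\<H>. H \<notin> J) \<and> H \<in> \<H> \<and> H \<in> derived J"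
  proof (rule least_rank)
    have "\<exists>c. (\<forall>b\<in>{1}. c b \<in> \<Gamma>) \<and> x = (\<Sum>b\<in>{1}. c b * b)" if "x \<in> \<Gamma>" for x
      using that by (intro exI[of _ "\<lambda>_. x"]) simp
    then have "finite_dim \<Gamma> \<Gamma>"
      unfolding finite_dim_def using \<Gamma>_one by (intro exI[of _ "{1}"]) simp
    moreover have "centralizer {} = (UNIV :: 'a set)" by (simp add: centralizer_def)
    ultimately have "centralizer {} \<in> \<H>" by (intro \<H>I) simp_all
    then show "\<H> \<noteq> {}" by blast
    fix H assume "H \<in> \<H>"
    then obtain S where "H = centralizer S" "finite S" "S \<subseteq> \<Gamma>" by (auto simp: \<H>_def)
    then show "defset M \<Gamma> H \<and> H \<noteq> {}"
      using defset_centralizer subring_zero[OF division_subring_centralizer[of S]] by auto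
  qed
  then obtain J H where J: "rank_ideal J" and avoid: "\<And>H. H \<in> \<H> \<Longrightarrow> H \<notin> J"
    and H: "H \<in> \<H>" "H \<in> derived J"
    by (elim exE conjE) blast
  obtain S where S: "H = centralizer S" "finite S" "S \<subseteq> \<Gamma>" "finite_dim (centralizer S \<inter> \<Gamma>) \<Gamma>"
    using H(1) by (auto simp: \<H>_def)
  define E where "E = centralizer S \<inter> \<Gamma>"
  have E: "division_subring E"
    unfolding E_def by (intro division_subring_Int division_subring_centralizer division_subring_\<Gamma>)
  have "a * c = c * a" if a: "a \<in> E" and c: "c \<in> E" for a c
  proof (rule ccontr)
    assume ac: "a * c \<noteq> c * a"
    let ?H' = "centralizer (insert a S)"
    define E' where "E' = ?H' \<inter> \<Gamma>"
    have H': "division_subring ?H'" by (rule division_subring_centralizer)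
    have E': "division_subring E'"
      unfolding E'_def using H' division_subring_\<Gamma> by (rule division_subring_Int)
    have step: "finite_dim E' E"
      unfolding E_def E'_def using a by (intro finite_dim_over_centralizer[OF p S(2,3)]) (simp_all add: E_def)
    have dim: "finite_dim E' \<Gamma>"
      by (rule finite_dim_trans[OF E' S(4)[folded E_def] step]) (simp add: E_def \<Gamma>_mult)
    then have "infinite E'" using False finite_if_finite_dim by blast
    have "c \<noteq> 0" using ac by auto
    have "inj_on (\<lambda>k. k * c) E'" using \<open>c \<noteq> 0\<close> by (intro inj_onI) simp
    then have inf: "infinite ((\<lambda>k. k * c) ` E')" using \<open>infinite E'\<close> by (simp add: finite_image_iff)
    have sub: "?H' \<subseteq> H" unfolding S(1) by (auto simp: centralizer_def)
    have sub': "(\<lambda>k. k * c) ` E' \<subseteq> H \<inter> \<Gamma>"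
    proof
      fix x assume "x \<in> (\<lambda>k. k * c) ` E'"
      then obtain k where k: "k \<in> E'" "x = k * c" by blast
      have "k \<in> E" using k(1) sub by (auto simp: E_def E'_def S(1))
      then have "x \<in> E" unfolding k(2) using c by (rule subring_mult[OF E])
      then show "x \<in> H \<inter> \<Gamma>" by (simp add: E_def S(1))
    qed
    have fin: "finite (insert a S)" "insert a S \<subseteq> \<Gamma>" using S a by (auto simp: E_def)
    have "?H' \<in> \<H>" using dim fin by (intro \<H>I) (simp_all add: E'_def)
    then have notJ: "?H' \<notin> J" by (rule avoid)
    have gH: "additive_subgroup H"
      unfolding S(1) by (intro additive_subgroup_if_division_subring division_subring_centralizer)
    obtain T where T: "T \<subseteq> (\<lambda>k. k * c) ` E'" "infinite T" "\<And>x y. x \<in> T \<Longrightarrow> y \<in> T \<Longrightarrow> x - y \<in> ?H'"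
      using equal_rank_finite_index[OF J H(2) defset_centralizer[OF fin]
          additive_subgroup_if_division_subring[OF H'] notJ gH sub inf sub'] by blast
    obtain x where x: "x \<in> T" using infinite_imp_nonempty[OF T(2)] by blast
    obtain y where y: "y \<in> T - {x}"
      using infinite_imp_nonempty[OF infinite_remove[OF T(2), of x]] by blast
    obtain k where k: "k \<in> E'" "x = k * c" using T(1) x by blast
    obtain l where l: "l \<in> E'" "y = l * c" using T(1) y by blast
    have kl: "k - l \<noteq> 0" using k l y by auto
    have mem: "(k - l) * c \<in> ?H'" using T(3)[OF x, of y] y k(2) l(2) by (simp add: left_diff_distrib)
    have "k - l \<in> ?H'" using subring_diff[OF E' k(1) l(1)] by (simp add: E'_def)
    then have "inverse (k - l) * ((k - l) * c) \<in> ?H'"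
      by (rule subring_mult[OF H' subring_inverse[OF H'] mem])
    moreover have "inverse (k - l) * ((k - l) * c) = c" using kl by (simp only: mult.assoc[symmetric]) simp
    ultimately have "c \<in> ?H'" by (simp only:)
    then show False using ac by (simp add: centralizer_def)
  qed
  moreover have "E \<subseteq> \<Gamma>" by (simp add: E_def)
  ultimately show ?thesis
    using S(4)[folded E_def] finite_dim_over_commutative_imp_centre[OF division_subring_\<Gamma> E] by blast
qed

end

theorem theorem3p8:
  fixes M :: "('f, 'r, 'a::division_ring) fo_struct"
  assumes "expands_ring M"
    and "weakly_small M"
    and "CHAR('a) > 0"
  shows "\<forall>A :: 'a set. finite A \<longrightarrow> finite_dim_over_centre (acl M A)"
proof (intro allI impI)
  fix A :: "'a set" assume "finite A"
  then interpret ring_closure M A by unfold_locales (use assms in simp_all)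
  show "finite_dim_over_centre (acl M A)"
    using finite_dim_over_centre_\<Gamma>[OF assms(3)] by (simp add: \<Gamma>_def)
qed

end
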